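(* Let $(W,S)$ be a Coxeter system. If $(W_J,J)$ is finite for all proper subsets $J$ of $S$, $\Gamma$ is a finite, connected $W$-digraph, and $M(\Gamma)$ affords a $W$-graph over $\mathbb Q$, then $\Gamma$ is acyclic.
   Context: Coxeter system: $W$ has presentation $\langle s\in S\mid (rs)^{n(r,s)}=e \text{ for } r,s\in S,\ n(r,s)<\infty\rangle$ with $n(s,s)=1$ and $1<n(r,s)=n(s,r)\le\infty$ for $r\ne s$; $\ell$ is the length function. For $J\subseteq S$, $W_J=\langle J\rangle$, and "$(W_J,J)$ is finite" means $W_J$ is finite. Hecke algebra: $u$ is an indeterminate and $H$ is the $\mathbb Q(u)$-algebra with basis $\{T_w\mid w\in W\}$ satisfying, for $s\in S$, $T_sT_w=T_{sw}$ if $\ell(sw)>\ell(w)$ and $T_sT_w=u^2T_{sw}+(u^2-1)T_w$ if $\ell(sw)<\ell(w)$. An $S$-labeled digraph is a directed multigraph $\Gamma$ with vertex set $\mathscr V(\Gamma)$ and edge set $\mathscr E(\Gamma)$, in which every edge is either solid or dashed and is labeled by an element of $S$ (written $\alpha\xrightarrow{s}\beta$ if solid, $\alpha\overset{s}{\dashrightarrow}\beta$ if dashed), such that $\Gamma$ has no loops and, for each $s\in S$, every vertex occurs in exactly one edge labeled $s$. It is finite if $\mathscr V(\Gamma)$ is finite. Let $M(\Gamma)$ be the $\mathbb Q(u)$-vector space with basis $\mathscr V(\Gamma)$. For $s\in S$ let $\tau_s$ be the linear operator on $M(\Gamma)$ with, for each vertex $\alpha$ (where $\beta$ is the other endpoint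 of the edge labeled $s$ at $\alpha$): $\tau_s(\alpha)=\beta$ if the edge is $\alpha\xrightarrow{s}\beta$; $\tau_s(\alpha)=(u^2-1)\alpha+u^2\beta$ if it is $\beta\xrightarrow{s}\alpha$; $\tau_s(\alpha)=u\alpha+(u+1)\beta$ if it is $\alpha\overset{s}{\dashrightarrow}\beta$; $\tau_s(\alpha)=(u^2-u-1)\alpha+(u^2-u)\beta$ if it is $\beta\overset{s}{\dashrightarrow}\alpha$. An $S$-labeled digraph $\Gamma$ is a $W$-digraph if $T_s\mapsto\tau_s$ ($s\in S$) extends to a homomorphism of $\mathbb Q(u)$-algebras from $H$ to the algebra of all linear operators on $M(\Gamma)$; then $M(\Gamma)$ is regarded as an $H$-module in this way. Ignoring types and labels of edges gives a directed multigraph: $\Gamma$ is acyclic if it has no nonempty directed circuit; $\Gamma$ is connected if the underlying undirected multigraph is connected. $W$-graph (in the sense of Kazhdan and Lusztig) over $\mathbb Q$: a graph $\Psi$ with vertex set $\mathscr V(\Psi)$ and a set of edges (two-element subsets of $\mathscr V(\Psi)$), together with a subset $I_x\subseteq S$ for each vertex $x$ and a nonzero scalar $\mu(y,x)\in\mathbb Q$ for each ordered pair $(y,x)$ such that $\{y,x\}$ is an edge, such that the operators on the $\mathbb Q(u)$-vector space $M(\Psi)$ with basis $\mathscr V(\Psi)$ given for $s\in S$ by $$x\mapsto -x \ \text{ if } s\in I_x,\qquad x\mapsto u^2x+u\sum_{y:\ \{y,x\}\text{ an edge},\ s\in I_y}\mu(y,x)\,y\ \text{ if } s\notin I_x$$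 define (via $T_s\mapsto$ the operator for $s$) an $H$-module structure on $M(\Psi)$. An $H$-module $M$ affords the $W$-graph $\Psi$ if $M\cong M(\Psi)$ as $H$-modules. *)

theory Defs
  imports
    "Graph_Theory.Graph_Theory"
    "Jordan_Normal_Form.VS_Connect"
    "HOL-Algebra.Generated_Groups"
    "HOL-Computational_Algebra.Fraction_Field"
    "HOL-Library.Poly_Mapping"
    "HOL-Library.Extended_Nat"
begin

section \<open>Coxeter systems\<close>

text \<open>
  A word over \<open>S\<close> is a list of letters \<open>(b, s)\<close> with \<open>s \<in> S\<close>: \<open>(True, s)\<close> stands for \<open>s\<close> and
  \<open>(False, s)\<close> for its formal inverse.
\<close>

type_synonym 'a gword = "(bool \<times> 'a) list"

definition words :: "'a set \<Rightarrow> 'a gword set" where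
  "words S = lists (UNIV \<times> S)"

fun letter_val :: "('a, 'b) monoid_scheme \<Rightarrow> bool \<times> 'a \<Rightarrow> 'a" where
  "letter_val G (b, s) = (if b then s else inv\<^bsub>G\<^esub> s)"

definition word_val :: "('a, 'b) monoid_scheme \<Rightarrow> 'a gword \<Rightarrow> 'a" where
  "word_val G w = foldr (\<lambda>l x. letter_val G l \<otimes>\<^bsub>G\<^esub> x) w \<one>\<^bsub>G\<^esub>"

text \<open>
  Equality of two words in the group \<open>\<langle>S | r = e for r \<in> R\<rangle>\<close>, that is, in the free group on \<open>S\<close>
  modulo the normal closure of \<open>R\<close>.
\<close>

inductive word_equiv :: "'a set \<Rightarrow> 'a gword set \<Rightarrow> 'a gword \<Rightarrow> 'a gword \<Rightarrow> bool"
  for S :: "'a set" and R :: "'a gword set" where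
  refl: "w \<in> words S \<Longrightarrow> word_equiv S R w w"
| sym: "word_equiv S R v w \<Longrightarrow> word_equiv S R w v"
| trans: "word_equiv S R v w \<Longrightarrow> word_equiv S R w x \<Longrightarrow> word_equiv S R v x"
| cancel: "x \<in> words S \<Longrightarrow> y \<in> words S \<Longrightarrow> s \<in> S \<Longrightarrow>
    word_equiv S R (x @ [(b, s), (\<not> b, s)] @ y) (x @ y)"
| relator: "x \<in> words S \<Longrightarrow> y \<in> words S \<Longrightarrow> r \<in> R \<Longrightarrow> word_equiv S R (x @ r @ y) (x @ y)"

definition has_presentation :: "('a, 'b) monoid_scheme \<Rightarrow> 'a set \<Rightarrow> 'a gword set \<Rightarrow> bool" where
  "has_presentation G S R \<longleftrightarrow>
     S \<subseteq> carrier G \<and> R \<subseteq> words S \<and> generate G S = carrier G \<and>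
     (\<forall>v\<in>words S. \<forall>w\<in>words S. word_val G v = word_val G w \<longleftrightarrow> word_equiv S R v w)"

definition coxeter_relators :: "'a set \<Rightarrow> ('a \<Rightarrow> 'a \<Rightarrow> enat) \<Rightarrow> 'a gword set" where
  "coxeter_relators S n =
     {concat (replicate k [(True, r), (True, s)]) | r s k. r \<in> S \<and> s \<in> S \<and> n r s = enat k}"

definition coxeter_system ::
  "('a, 'b) monoid_scheme \<Rightarrow> 'a set \<Rightarrow> ('a \<Rightarrow> 'a \<Rightarrow> enat) \<Rightarrow> bool" where
  "coxeter_system G S n \<longleftrightarrow>
     group G \<and>
     (\<forall>s\<in>S. n s s = 1) \<and>
     (\<forall>r\<in>S. \<forall>s\<in>S. r \<noteq> s \<longrightarrow> 1 < n r s \<and> n r s = n s r) \<and>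
     has_presentation G S (coxeter_relators S n)"

definition len :: "('a, 'b) monoid_scheme \<Rightarrow> 'a set \<Rightarrow> 'a \<Rightarrow> nat" where
  "len G S w = (LEAST k. \<exists>v\<in>words S. length v = k \<and> word_val G v = w)"


section \<open>The ground field and linear algebra over it\<close>

type_synonym ratfun = "rat poly fract"

definition rf_u :: ratfun where
  "rf_u = Fraction_Field.Fract [:0, 1:] 1"

definition rf_const :: "rat \<Rightarrow> ratfun" where
  "rf_const q = Fraction_Field.Fract [:q:] 1"

abbreviation Qu :: "ratfun ring" where
  "Qu \<equiv> class_ring"

text \<open>
  The vector space with basis \<open>X\<close>: formal linear combinations of elements of \<open>X\<close>, where
  \<open>Poly_Mapping.single x 1\<close> is the basis vector \<open>x\<close>. The multiplicative fields of the record play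
  no role in a module.
\<close>

definition scl :: "ratfun \<Rightarrow> ('x \<Rightarrow>\<^sub>0 ratfun) \<Rightarrow> ('x \<Rightarrow>\<^sub>0 ratfun)" where
  "scl c f = Poly_Mapping.map ((*) c) f"

definition free_space :: "'x set \<Rightarrow> (ratfun, 'x \<Rightarrow>\<^sub>0 ratfun) module" where
  "free_space X = \<lparr> carrier = {f. Poly_Mapping.keys f \<subseteq> X}, mult = undefined, one = undefined,
     zero = 0, add = (+), smult = scl \<rparr>"

text \<open>
  Operators on a module \<open>M\<close> are represented by functions that are \<open>undefined\<close> off \<open>carrier M\<close>.
  The following is the linear operator on \<open>free_space X\<close> with prescribed values \<open>t x\<close> at the
  basis vectors \<open>x \<in> X\<close>.
\<close>

definition linear_extension ::
  "'x set \<Rightarrow> ('x \<Rightarrow> ('x \<Rightarrow>\<^sub>0 ratfun)) \<Rightarrow> ('x \<Rightarrow>\<^sub>0 ratfun) \<Rightarrow> ('x \<Rightarrow>\<^sub>0 ratfun)" where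
  "linear_extension X t =
     (\<lambda>f\<in>carrier (free_space X).
        \<Sum>x\<in>Poly_Mapping.keys f. scl (Poly_Mapping.lookup f x) (t x))"

definition End_alg :: "('k, 'c) ring_scheme \<Rightarrow> ('k, 'm) module \<Rightarrow> ('k, 'm \<Rightarrow> 'm) module" where
  "End_alg K M = \<lparr>
     carrier = module_hom K M M \<inter> extensional (carrier M),
     mult = compose (carrier M),
     one = (\<lambda>x\<in>carrier M. x),
     zero = (\<lambda>x\<in>carrier M. \<zero>\<^bsub>M\<^esub>),
     add = (\<lambda>f g. \<lambda>x\<in>carrier M. f x \<oplus>\<^bsub>M\<^esub> g x),
     smult = (\<lambda>c f. \<lambda>x\<in>carrier M. c \<odot>\<^bsub>M\<^esub> f x) \<rparr>"

text \<open>
  The locale \<^locale>\<open>algebra\<close> of HOL-Algebra is restricted to commutative algebras, hence this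
  definition of associative unital algebras over a field.
\<close>

definition assoc_algebra :: "('k, 'c) ring_scheme \<Rightarrow> ('k, 'h) module \<Rightarrow> bool" where
  "assoc_algebra K A \<longleftrightarrow>
     vectorspace K A \<and> ring A \<and>
     (\<forall>c\<in>carrier K. \<forall>x\<in>carrier A. \<forall>y\<in>carrier A.
        (c \<odot>\<^bsub>A\<^esub> x) \<otimes>\<^bsub>A\<^esub> y = c \<odot>\<^bsub>A\<^esub> (x \<otimes>\<^bsub>A\<^esub> y) \<and>
        x \<otimes>\<^bsub>A\<^esub> (c \<odot>\<^bsub>A\<^esub> y) = c \<odot>\<^bsub>A\<^esub> (x \<otimes>\<^bsub>A\<^esub> y))"

definition algebra_hom ::
  "('k, 'c) ring_scheme \<Rightarrow> ('k, 'h) module \<Rightarrow> ('k, 'g) module \<Rightarrow> ('h \<Rightarrow> 'g) set" where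
  "algebra_hom K A B = Ring.ring_hom A B \<inter> module_hom K A B"


section \<open>The Hecke algebra and its modules\<close>

text \<open>
  \<open>H\<close> is characterised, up to isomorphism, as an algebra with basis \<open>T w\<close> (\<open>w\<close> in \<open>W\<close>) and the
  given multiplication rules. For nonempty \<open>S\<close> these rules force \<open>T e = 1\<close>.
\<close>

definition hecke_algebra ::
  "('a, 'b) monoid_scheme \<Rightarrow> 'a set \<Rightarrow> (ratfun, 'h) module \<Rightarrow> ('a \<Rightarrow> 'h) \<Rightarrow> bool" where
  "hecke_algebra G S H T \<longleftrightarrow>
     assoc_algebra Qu H \<and>
     inj_on T (carrier G) \<and> vectorspace.basis Qu H (T ` carrier G) \<and>
     (\<forall>s\<in>S. \<forall>w\<in>carrier G.
        (len G S (s \<otimes>\<^bsub>G\<^esub> w) > len G S w \<longrightarrow> T s \<otimes>\<^bsub>H\<^esub> T w = T (s \<otimes>\<^bsub>G\<^esub> w)) \<and>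
        (len G S (s \<otimes>\<^bsub>G\<^esub> w) < len G S w \<longrightarrow>
           T s \<otimes>\<^bsub>H\<^esub> T w =
             rf_u\<^sup>2 \<odot>\<^bsub>H\<^esub> T (s \<otimes>\<^bsub>G\<^esub> w) \<oplus>\<^bsub>H\<^esub> (rf_u\<^sup>2 - 1) \<odot>\<^bsub>H\<^esub> T w))"

text \<open>
  \<open>\<phi>\<close> is an algebra homomorphism from \<open>H\<close> to the linear operators on \<open>M\<close> that extends
  \<open>T s \<mapsto> op s\<close>. It is unique on \<open>carrier H\<close>, as the \<open>T s\<close> generate \<open>H\<close>.
\<close>

definition extends_to_action ::
  "'a set \<Rightarrow> (ratfun, 'h) module \<Rightarrow> ('a \<Rightarrow> 'h) \<Rightarrow> (ratfun, 'm) module \<Rightarrow>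
   ('a \<Rightarrow> 'm \<Rightarrow> 'm) \<Rightarrow> ('h \<Rightarrow> 'm \<Rightarrow> 'm) \<Rightarrow> bool" where
  "extends_to_action S H T M op \<phi> \<longleftrightarrow>
     \<phi> \<in> algebra_hom Qu H (End_alg Qu M) \<and> (\<forall>s\<in>S. \<phi> (T s) = op s)"

text \<open>Isomorphism of the \<open>H\<close>-modules \<open>(M, \<phi>)\<close> and \<open>(N, \<psi>)\<close>.\<close>

definition H_isomorphic ::
  "(ratfun, 'h) module \<Rightarrow> (ratfun, 'm) module \<Rightarrow> ('h \<Rightarrow> 'm \<Rightarrow> 'm) \<Rightarrow>
   (ratfun, 'n) module \<Rightarrow> ('h \<Rightarrow> 'n \<Rightarrow> 'n) \<Rightarrow> bool" where
  "H_isomorphic H M \<phi> N \<psi> \<longleftrightarrow>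
     (\<exists>f. f \<in> module_hom Qu M N \<and> bij_betw f (carrier M) (carrier N) \<and>
          (\<forall>h\<in>carrier H. \<forall>x\<in>carrier M. f (\<phi> h x) = \<psi> h (f x)))"


section \<open>\<open>W\<close>-digraphs\<close>

text \<open>An edge is solid iff it is not dashed.\<close>

record ('v, 'e, 's) labeled_digraph =
  multigraph :: "('v, 'e) pre_digraph"
  label :: "'e \<Rightarrow> 's"
  dashed :: "'e \<Rightarrow> bool"

abbreviation lverts :: "('v, 'e, 's) labeled_digraph \<Rightarrow> 'v set" where
  "lverts \<Gamma> \<equiv> verts (multigraph \<Gamma>)"

definition is_edge_at :: "('v, 'e, 's) labeled_digraph \<Rightarrow> 's \<Rightarrow> 'v \<Rightarrow> 'e \<Rightarrow> bool" where
  "is_edge_at \<Gamma> s \<alpha> e \<longleftrightarrow>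
     e \<in> arcs (multigraph \<Gamma>) \<and> label \<Gamma> e = s \<and>
     (tail (multigraph \<Gamma>) e = \<alpha> \<or> head (multigraph \<Gamma>) e = \<alpha>)"

definition S_labeled_digraph :: "'s set \<Rightarrow> ('v, 'e, 's) labeled_digraph \<Rightarrow> bool" where
  "S_labeled_digraph S \<Gamma> \<longleftrightarrow>
     loopfree_digraph (multigraph \<Gamma>) \<and>
     (\<forall>e\<in>arcs (multigraph \<Gamma>). label \<Gamma> e \<in> S) \<and>
     (\<forall>s\<in>S. \<forall>\<alpha>\<in>lverts \<Gamma>. \<exists>!e. is_edge_at \<Gamma> s \<alpha> e)"

definition tau_vec :: "('v, 'e, 's) labeled_digraph \<Rightarrow> 's \<Rightarrow> 'v \<Rightarrow> ('v \<Rightarrow>\<^sub>0 ratfun)" where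
  "tau_vec \<Gamma> s \<alpha> =
     (let e = (THE e. is_edge_at \<Gamma> s \<alpha> e);
          t = tail (multigraph \<Gamma>) e; h = head (multigraph \<Gamma>) e
      in if t = \<alpha>
         then (if \<not> dashed \<Gamma> e then Poly_Mapping.single h 1
               else Poly_Mapping.single \<alpha> rf_u + Poly_Mapping.single h (rf_u + 1))
         else (if \<not> dashed \<Gamma> e
               then Poly_Mapping.single \<alpha> (rf_u\<^sup>2 - 1) + Poly_Mapping.single t (rf_u\<^sup>2)
               else Poly_Mapping.single \<alpha> (rf_u\<^sup>2 - rf_u - 1)
                    + Poly_Mapping.single t (rf_u\<^sup>2 - rf_u)))"

definition digraph_space :: "('v, 'e, 's) labeled_digraph \<Rightarrow> (ratfun, 'v \<Rightarrow>\<^sub>0 ratfun) module" where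
  "digraph_space \<Gamma> = free_space (lverts \<Gamma>)"

definition tau ::
  "('v, 'e, 's) labeled_digraph \<Rightarrow> 's \<Rightarrow> ('v \<Rightarrow>\<^sub>0 ratfun) \<Rightarrow> ('v \<Rightarrow>\<^sub>0 ratfun)" where
  "tau \<Gamma> s = linear_extension (lverts \<Gamma>) (tau_vec \<Gamma> s)"

definition W_digraph ::
  "'s set \<Rightarrow> (ratfun, 'h) module \<Rightarrow> ('s \<Rightarrow> 'h) \<Rightarrow> ('v, 'e, 's) labeled_digraph \<Rightarrow> bool" where
  "W_digraph S H T \<Gamma> \<longleftrightarrow>
     S_labeled_digraph S \<Gamma> \<and> (\<exists>\<phi>. extends_to_action S H T (digraph_space \<Gamma>) (tau \<Gamma>) \<phi>)"

definition acyclic_digraph :: "('v, 'e, 's) labeled_digraph \<Rightarrow> bool" where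
  "acyclic_digraph \<Gamma> \<longleftrightarrow> (\<nexists>p. wf_digraph.closed_w (multigraph \<Gamma>) p)"

text \<open>The null digraph is not connected in the sense of the library.\<close>

definition connected_digraph :: "('v, 'e, 's) labeled_digraph \<Rightarrow> bool" where
  "connected_digraph \<Gamma> \<longleftrightarrow> Digraph_Component.connected (multigraph \<Gamma>)"


section \<open>\<open>W\<close>-graphs over the rationals\<close>

text \<open>
  \<open>wmu \<Psi> y x\<close> is relevant only if \<open>{y, x}\<close> is an edge, and \<open>wI \<Psi> x\<close> only if \<open>x\<close> is a vertex.
\<close>

record ('x, 's) wgraph =
  wverts :: "'x set"
  wedges :: "'x set set"
  wI :: "'x \<Rightarrow> 's set"
  wmu :: "'x \<Rightarrow> 'x \<Rightarrow> rat"

definition wgraph_nbrs :: "('x, 's) wgraph \<Rightarrow> 's \<Rightarrow> 'x \<Rightarrow> 'x set" where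
  "wgraph_nbrs \<Psi> s x = {y. {y, x} \<in> wedges \<Psi> \<and> s \<in> wI \<Psi> y}"

definition wgraph_vec :: "('x, 's) wgraph \<Rightarrow> 's \<Rightarrow> 'x \<Rightarrow> ('x \<Rightarrow>\<^sub>0 ratfun)" where
  "wgraph_vec \<Psi> s x =
     (if s \<in> wI \<Psi> x then Poly_Mapping.single x (-1)
      else Poly_Mapping.single x (rf_u\<^sup>2) +
           scl rf_u (\<Sum>y\<in>wgraph_nbrs \<Psi> s x. Poly_Mapping.single y (rf_const (wmu \<Psi> y x))))"

definition wgraph_space :: "('x, 's) wgraph \<Rightarrow> (ratfun, 'x \<Rightarrow>\<^sub>0 ratfun) module" where
  "wgraph_space \<Psi> = free_space (wverts \<Psi>)"

definition wgraph_op ::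
  "('x, 's) wgraph \<Rightarrow> 's \<Rightarrow> ('x \<Rightarrow>\<^sub>0 ratfun) \<Rightarrow> ('x \<Rightarrow>\<^sub>0 ratfun)" where
  "wgraph_op \<Psi> s = linear_extension (wverts \<Psi>) (wgraph_vec \<Psi> s)"

text \<open>
  The finiteness condition says that the sums defining the operators make sense; it is automatic
  when the vertex set is finite.
\<close>

definition W_graph ::
  "'s set \<Rightarrow> (ratfun, 'h) module \<Rightarrow> ('s \<Rightarrow> 'h) \<Rightarrow> ('x, 's) wgraph \<Rightarrow> bool" where
  "W_graph S H T \<Psi> \<longleftrightarrow>
     (\<forall>e\<in>wedges \<Psi>. e \<subseteq> wverts \<Psi> \<and> card e = 2) \<and>
     (\<forall>x\<in>wverts \<Psi>. wI \<Psi> x \<subseteq> S) \<and>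
     (\<forall>x y. {y, x} \<in> wedges \<Psi> \<longrightarrow> wmu \<Psi> y x \<noteq> 0) \<and>
     (\<forall>s\<in>S. \<forall>x\<in>wverts \<Psi>. s \<notin> wI \<Psi> x \<longrightarrow> finite (wgraph_nbrs \<Psi> s x)) \<and>
     (\<exists>\<psi>. extends_to_action S H T (wgraph_space \<Psi>) (wgraph_op \<Psi>) \<psi>)"

text \<open>The \<open>H\<close>-module \<open>(M, \<phi>)\<close> affords the \<open>W\<close>-graph \<open>\<Psi>\<close>.\<close>

definition affords ::
  "'s set \<Rightarrow> (ratfun, 'h) module \<Rightarrow> ('s \<Rightarrow> 'h) \<Rightarrow> (ratfun, 'm) module \<Rightarrow> ('h \<Rightarrow> 'm \<Rightarrow> 'm) \<Rightarrow>
   ('x, 's) wgraph \<Rightarrow> bool" where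
  "affords S H T M \<phi> \<Psi> \<longleftrightarrow>
     W_graph S H T \<Psi> \<and>
     (\<exists>\<psi>. extends_to_action S H T (wgraph_space \<Psi>) (wgraph_op \<Psi>) \<psi> \<and>
          H_isomorphic H M \<phi> (wgraph_space \<Psi>) \<psi>)"

end

theory Submission
  imports Defs
begin

text \<open>
  Suppose that there is a directed circuit through \<open>\<alpha>\<^sub>0\<close>, let \<open>w\<close> be the word of its labels and
  \<open>J\<close> the set of these labels. For \<open>s \<in> S\<close> let \<open>f\<^sub>s\<close> be the map of the vertices of \<open>\<Gamma>\<close> that moves
  the tail of each edge labeled \<open>s\<close> to its head and fixes the head; composing along \<open>w\<close> gives a map
  \<open>f\<^sub>w\<close>, and \<open>f\<^sub>w \<alpha>\<^sub>0 = \<alpha>\<^sub>0\<close>. On a finite set some power of \<open>f\<^sub>w\<close> is idempotent. It belongs to a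
  word \<open>v\<close> that is a repetition of \<open>w\<close>; let \<open>P\<close> be the set of fixed points of \<open>f\<^sub>v\<close>, so that
  \<open>\<alpha>\<^sub>0 \<in> P\<close> and \<open>f\<^sub>v\<close> maps all vertices to \<open>P\<close>. Let \<open>X\<close> be the set of vertices \<open>x\<close> of the
  \<open>W\<close>-graph with \<open>J \<subseteq> I\<^sub>x\<close>. The cardinalities of \<open>P\<close> and \<open>X\<close> are compared in two ways.

  The first is specialization at \<open>u = 0\<close>. There \<open>\<tau>\<^sub>s\<close> becomes the map \<open>\<alpha> \<mapsto> \<plusminus>f\<^sub>s \<alpha>\<close>, while the operator
  of the \<open>W\<close>-graph becomes diagonal with entries \<open>-1\<close> (if \<open>s \<in> I\<^sub>x\<close>) and \<open>0\<close>. The two modules need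
  not be isomorphic after specialization, but the traces of the Hecke algebra elements, which lie in
  the local ring of \<open>u = 0\<close>, agree before and hence after. For the product along \<open>v v\<close> the two
  traces are \<open>card P\<close> and \<open>card X\<close>, so \<open>card P = card X\<close> (\<open>card_fixed_points_eq\<close>).

  The second is the space of vectors on which every \<open>T\<^sub>s\<close> with \<open>s \<in> J\<close> acts as \<open>-1\<close>, over the field
  \<open>\<rat>(u)\<close>. In the module of the \<open>W\<close>-graph it contains the span of \<open>X\<close>. In the module of \<open>\<Gamma>\<close>, the
  coefficient of such a vector at the tail of an edge is the coefficient at the head times a function
  vanishing at \<open>u = 0\<close> (\<open>sign_vector_step\<close>). Following \<open>v\<close>, all coefficients are determined by those
  on \<open>P\<close>; following the circuit, the coefficient at \<open>\<alpha>\<^sub>0\<close> equals itself times a function vanishing at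
  \<open>u = 0\<close> and so is \<open>0\<close>. Hence the space has dimension at most \<open>card P - 1\<close>, and
  \<open>card X < card P\<close>, a contradiction.
\<close>

section \<open>Reduction of rational functions at the origin\<close>

text \<open>
  The reduction map from the local ring of \<open>u = 0\<close> in \<open>\<rat>(u)\<close> to its residue field, as a relation.
\<close>

definition reduces_to :: "ratfun \<Rightarrow> rat \<Rightarrow> bool" where
  "reduces_to x c \<longleftrightarrow>
     (\<exists>p q. poly q 0 \<noteq> 0 \<and> x = Fraction_Field.Fract p q \<and> poly p 0 = c * poly q 0)"

lemma reduces_to_unique:
  assumes "reduces_to x c" "reduces_to x d"
  shows "c = d"
proof -
  from assms obtain p q p' q' where 1: "poly q 0 \<noteq> 0" "x = Fraction_Field.Fract p q"
      "poly p 0 = c * poly q 0"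
    and 2: "poly q' 0 \<noteq> 0" "x = Fraction_Field.Fract p' q'" "poly p' 0 = d * poly q' 0"
    unfolding reduces_to_def by blast
  have "q \<noteq> 0" "q' \<noteq> 0" using 1 2 by auto
  then have "p * q' = p' * q" using 1(2) 2(2) by (auto simp: eq_fract)
  then have "poly p 0 * poly q' 0 = poly p' 0 * poly q 0" by (metis poly_mult)
  then show ?thesis using 1 2 by (simp add: mult.commute)
qed

lemma reduces_to_Fract_1: "reduces_to (Fraction_Field.Fract p 1) (poly p 0)"
  unfolding reduces_to_def by (rule exI[of _ p], rule exI[of _ 1]) auto

lemma reduces_to_0: "reduces_to 0 0"
  using reduces_to_Fract_1[of 0] by (simp add: Zero_fract_def)

lemma reduces_to_1: "reduces_to 1 1"
  using reduces_to_Fract_1[of 1] by (simp add: One_fract_def)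

lemma reduces_to_u: "reduces_to rf_u 0"
  using reduces_to_Fract_1[of "[:0, 1:]"] by (simp add: rf_u_def)

lemma reduces_to_const: "reduces_to (rf_const c) c"
  using reduces_to_Fract_1[of "[:c:]"] by (simp add: rf_const_def)

lemma reduces_to_add:
  assumes "reduces_to x c" "reduces_to y d"
  shows "reduces_to (x + y) (c + d)"
proof -
  from assms obtain p q p' q' where 1: "poly q 0 \<noteq> 0" "x = Fraction_Field.Fract p q"
      "poly p 0 = c * poly q 0"
    and 2: "poly q' 0 \<noteq> 0" "y = Fraction_Field.Fract p' q'" "poly p' 0 = d * poly q' 0"
    unfolding reduces_to_def by blast
  have "q \<noteq> 0" "q' \<noteq> 0" using 1 2 by auto
  then have "x + y = Fraction_Field.Fract (p * q' + p' * q) (q * q')" using 1 2 by simp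
  moreover have "poly (q * q') 0 \<noteq> 0" using 1 2 by simp
  moreover have "poly (p * q' + p' * q) 0 = (c + d) * poly (q * q') 0"
    using 1 2 by (simp add: algebra_simps)
  ultimately show ?thesis unfolding reduces_to_def by blast
qed

lemma reduces_to_mult:
  assumes "reduces_to x c" "reduces_to y d"
  shows "reduces_to (x * y) (c * d)"
proof -
  from assms obtain p q p' q' where 1: "poly q 0 \<noteq> 0" "x = Fraction_Field.Fract p q"
      "poly p 0 = c * poly q 0"
    and 2: "poly q' 0 \<noteq> 0" "y = Fraction_Field.Fract p' q'" "poly p' 0 = d * poly q' 0"
    unfolding reduces_to_def by blast
  have "x * y = Fraction_Field.Fract (p * p') (q * q')" using 1 2 by simp
  moreover have "poly (q * q') 0 \<noteq> 0" using 1 2 by simp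
  moreover have "poly (p * p') 0 = (c * d) * poly (q * q') 0"
    using 1 2 by (simp add: algebra_simps)
  ultimately show ?thesis unfolding reduces_to_def by blast
qed

lemma reduces_to_uminus:
  assumes "reduces_to x c"
  shows "reduces_to (- x) (- c)"
proof -
  have "reduces_to (- 1) (- 1)"
    using reduces_to_Fract_1[of "- 1"] by (simp add: One_fract_def)
  from reduces_to_mult[OF this assms] show ?thesis by simp
qed

lemma reduces_to_diff:
  assumes "reduces_to x c" "reduces_to y d"
  shows "reduces_to (x - y) (c - d)"
  using reduces_to_add[OF assms(1) reduces_to_uminus[OF assms(2)]] by simp

lemma reduces_to_power:
  assumes "reduces_to x c"
  shows "reduces_to (x ^ k) (c ^ k)"
  by (induction k) (auto intro: reduces_to_1 reduces_to_mult assms)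

lemma reduces_to_inverse:
  assumes "reduces_to x c" "c \<noteq> 0"
  shows "reduces_to (inverse x) (inverse c)"
proof -
  from assms obtain p q where 1: "poly q 0 \<noteq> 0" "x = Fraction_Field.Fract p q"
      "poly p 0 = c * poly q 0"
    unfolding reduces_to_def by blast
  have "poly p 0 \<noteq> 0" "inverse x = Fraction_Field.Fract q p" "poly q 0 = inverse c * poly p 0"
    using 1 assms(2) by auto
  then show ?thesis unfolding reduces_to_def by blast
qed

lemma reduces_to_sum:
  assumes "\<And>i. i \<in> I \<Longrightarrow> reduces_to (f i) (c i)"
  shows "reduces_to (\<Sum>i\<in>I. f i) (\<Sum>i\<in>I. c i)"
  using assms
  by (induction I rule: infinite_finite_induct) (auto intro: reduces_to_0 reduces_to_add)


section \<open>Matrix entries of linear maps between free spaces\<close>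

lemma lookup_scl [simp]: "Poly_Mapping.lookup (scl c f) x = c * Poly_Mapping.lookup f x"
  by (auto simp: scl_def map.rep_eq when_def)

lemma keys_scl: "Poly_Mapping.keys (scl c f) \<subseteq> Poly_Mapping.keys f"
  by (auto simp: in_keys_iff)

lemma carrier_free_space [simp]: "carrier (free_space X) = {f. Poly_Mapping.keys f \<subseteq> X}"
  by (simp add: free_space_def)

lemma free_hom_iff:
  "f \<in> module_hom Qu (free_space X) (free_space Y) \<longleftrightarrow>
     (\<forall>v. Poly_Mapping.keys v \<subseteq> X \<longrightarrow> Poly_Mapping.keys (f v) \<subseteq> Y) \<and>
     (\<forall>v w. Poly_Mapping.keys v \<subseteq> X \<and> Poly_Mapping.keys w \<subseteq> X \<longrightarrow> f (v + w) = f v + f w) \<and>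
     (\<forall>c v. Poly_Mapping.keys v \<subseteq> X \<longrightarrow> f (scl c v) = scl c (f v))"
  by (auto simp: module_hom_def free_space_def class_ring_simps)

lemma free_hom_comp:
  assumes "f \<in> module_hom Qu (free_space X) (free_space Y)"
    and "g \<in> module_hom Qu (free_space Y) (free_space Z)"
  shows "g \<circ> f \<in> module_hom Qu (free_space X) (free_space Z)"
  using assms unfolding free_hom_iff by simp

lemma free_hom_inv:
  assumes g: "g \<in> module_hom Qu (free_space X) (free_space Y)"
    and bij: "bij_betw g (carrier (free_space X)) (carrier (free_space Y))"
  shows "inv_into (carrier (free_space X)) g \<in> module_hom Qu (free_space Y) (free_space X)"
proof -
  define h where "h = inv_into (carrier (free_space X)) g"
  note G = g[unfolded free_hom_iff]
  have hX: "Poly_Mapping.keys (h v) \<subseteq> X" if "Poly_Mapping.keys v \<subseteq> Y" for v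
    using bij_betw_apply[OF bij_betw_inv_into[OF bij], of v] that by (simp add: h_def)
  have gh: "g (h v) = v" if "Poly_Mapping.keys v \<subseteq> Y" for v
    using bij_betw_inv_into_right[OF bij, of v] that by (simp add: h_def)
  have hg: "h (g v) = v" if "Poly_Mapping.keys v \<subseteq> X" for v
    using bij_betw_inv_into_left[OF bij, of v] that by (simp add: h_def)
  have "h (v + w) = h v + h w" if "Poly_Mapping.keys v \<subseteq> Y" "Poly_Mapping.keys w \<subseteq> Y" for v w
  proof -
    have "Poly_Mapping.keys (h v + h w) \<subseteq> X"
      using hX that keys_add[of "h v" "h w"] by blast
    moreover have "g (h v + h w) = v + w" using G hX gh that by metis
    ultimately show ?thesis using hg by metis
  qed
  moreover have "h (scl c v) = scl c (h v)" if "Poly_Mapping.keys v \<subseteq> Y" for c v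
  proof -
    have "Poly_Mapping.keys (scl c (h v)) \<subseteq> X"
      using hX that keys_scl[of c "h v"] by blast
    moreover have "g (scl c (h v)) = scl c v" using G hX gh that by metis
    ultimately show ?thesis using hg by metis
  qed
  ultimately show ?thesis using hX unfolding h_def[symmetric] free_hom_iff by blast
qed

definition entry :: "(('x \<Rightarrow>\<^sub>0 ratfun) \<Rightarrow> ('y \<Rightarrow>\<^sub>0 ratfun)) \<Rightarrow> 'x \<Rightarrow> 'y \<Rightarrow> ratfun" where
  "entry f x y = Poly_Mapping.lookup (f (Poly_Mapping.single x 1)) y"

lemma lookup_free_hom:
  assumes f: "f \<in> module_hom Qu (free_space X) (free_space Y)"
    and "finite X" and v: "Poly_Mapping.keys v \<subseteq> X"
  shows "Poly_Mapping.lookup (f v) y = (\<Sum>x\<in>X. Poly_Mapping.lookup v x * entry f x y)"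
proof -
  define b where "b = (\<lambda>x. scl (Poly_Mapping.lookup v x) (Poly_Mapping.single x 1))"
  have keys_b: "Poly_Mapping.keys (b x) \<subseteq> X" if "x \<in> X" for x
    using keys_scl that by (fastforce simp: b_def)
  have "Poly_Mapping.keys (\<Sum>x\<in>F. b x) \<subseteq> X \<and> f (\<Sum>x\<in>F. b x) = (\<Sum>x\<in>F. f (b x))"
    if "finite F" "F \<subseteq> X" for F
    using that
  proof (induction F)
    case empty
    have "scl 0 (0 :: 'a \<Rightarrow>\<^sub>0 ratfun) = 0" "scl 0 (f 0) = 0"
      by (auto intro!: poly_mapping_eqI)
    moreover have "f (scl 0 0) = scl 0 (f 0)"
      using f unfolding free_hom_iff by (metis empty_subsetI keys_zero)
    ultimately have "f 0 = 0" by simp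
    then show ?case by simp
  next
    case (insert x F)
    then have IH: "Poly_Mapping.keys (sum b F) \<subseteq> X" "f (sum b F) = (\<Sum>x\<in>F. f (b x))"
      and bx: "Poly_Mapping.keys (b x) \<subseteq> X" using keys_b by auto
    have "Poly_Mapping.keys (b x + sum b F) \<subseteq> X"
      using IH(1) bx keys_add[of "b x" "sum b F"] by blast
    moreover have "f (b x + sum b F) = f (b x) + f (sum b F)"
      using f IH(1) bx unfolding free_hom_iff by metis
    ultimately show ?case using insert.hyps IH(2) by simp
  qed
  then have sum_b: "f (\<Sum>x\<in>X. b x) = (\<Sum>x\<in>X. f (b x))" using \<open>finite X\<close> by blast
  have "v = (\<Sum>x\<in>X. b x)"
  proof (rule poly_mapping_eqI)
    fix k
    have "Poly_Mapping.lookup (\<Sum>x\<in>X. b x) k =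
        (\<Sum>x\<in>X. if x = k then Poly_Mapping.lookup v k else 0)"
      unfolding lookup_sum b_def by (rule sum.cong) (auto simp: lookup_single when_def)
    also have "\<dots> = Poly_Mapping.lookup v k"
      using v \<open>finite X\<close> by (auto simp: in_keys_iff)
    finally show "Poly_Mapping.lookup v k = Poly_Mapping.lookup (\<Sum>x\<in>X. b x) k" ..
  qed
  then have "f v = (\<Sum>x\<in>X. f (b x))" using sum_b by simp
  also have "\<dots> = (\<Sum>x\<in>X. scl (Poly_Mapping.lookup v x) (f (Poly_Mapping.single x 1)))"
  proof (rule sum.cong)
    fix x assume "x \<in> X"
    then have "Poly_Mapping.keys (Poly_Mapping.single x (1::ratfun)) \<subseteq> X" by auto
    then show "f (b x) = scl (Poly_Mapping.lookup v x) (f (Poly_Mapping.single x 1))"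
      using f unfolding free_hom_iff b_def by blast
  qed simp
  finally show ?thesis by (simp add: lookup_sum entry_def)
qed

lemma entry_comp:
  assumes f: "f \<in> module_hom Qu (free_space X) (free_space Y)"
    and g: "g \<in> module_hom Qu (free_space Y) (free_space Z)"
    and "finite Y" and "x \<in> X"
  shows "entry (g \<circ> f) x z = (\<Sum>y\<in>Y. entry f x y * entry g y z)"
proof -
  have "Poly_Mapping.keys (f (Poly_Mapping.single x 1)) \<subseteq> Y"
    using f \<open>x \<in> X\<close> unfolding free_hom_iff by (metis empty_subsetI insert_subset keys_single zero_neq_one)
  from lookup_free_hom[OF g \<open>finite Y\<close> this] show ?thesis by (simp add: entry_def)
qed

definition op_trace :: "'x set \<Rightarrow> (('x \<Rightarrow>\<^sub>0 ratfun) \<Rightarrow> ('x \<Rightarrow>\<^sub>0 ratfun)) \<Rightarrow> ratfun" where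
  "op_trace X f = (\<Sum>x\<in>X. entry f x x)"

lemma op_trace_comp_commute:
  assumes f: "f \<in> module_hom Qu (free_space X) (free_space Y)"
    and g: "g \<in> module_hom Qu (free_space Y) (free_space X)"
    and "finite X" "finite Y"
  shows "op_trace X (g \<circ> f) = op_trace Y (f \<circ> g)"
proof -
  have "op_trace X (g \<circ> f) = (\<Sum>x\<in>X. \<Sum>y\<in>Y. entry f x y * entry g y x)"
    unfolding op_trace_def using entry_comp[OF f g \<open>finite Y\<close>] by simp
  also have "\<dots> = (\<Sum>y\<in>Y. \<Sum>x\<in>X. entry g y x * entry f x y)"
    by (subst sum.swap) (simp add: mult.commute)
  also have "\<dots> = op_trace Y (f \<circ> g)"
    unfolding op_trace_def using entry_comp[OF g f \<open>finite X\<close>] by simp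
  finally show ?thesis .
qed

text \<open>
  The finitely many images of the basis vectors in \<open>X\<close> have finite support altogether, and every
  basis vector in \<open>Y\<close> lies in their span.
\<close>

lemma free_hom_surj_finite:
  assumes g: "g \<in> module_hom Qu (free_space X) (free_space Y)"
    and surj: "g ` carrier (free_space X) = carrier (free_space Y)" and "finite X"
  shows "finite Y"
proof -
  have "Y \<subseteq> (\<Union>x\<in>X. Poly_Mapping.keys (g (Poly_Mapping.single x 1)))"
  proof
    fix y assume "y \<in> Y"
    then have "Poly_Mapping.single y 1 \<in> g ` carrier (free_space X)" unfolding surj by simp
    then obtain v where "v \<in> carrier (free_space X)" "Poly_Mapping.single y 1 = g v"
      by (rule imageE)
    then have v: "Poly_Mapping.keys v \<subseteq> X" "g v = Poly_Mapping.single y 1" by auto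
    from lookup_free_hom[OF g \<open>finite X\<close> v(1), of y] v(2)
    have "(\<Sum>x\<in>X. Poly_Mapping.lookup v x * entry g x y) \<noteq> 0" by simp
    then obtain x where "x \<in> X" "Poly_Mapping.lookup v x * entry g x y \<noteq> 0"
      by (rule sum.not_neutral_contains_not_neutral)
    then have "x \<in> X" "entry g x y \<noteq> 0" by auto
    then show "y \<in> (\<Union>x\<in>X. Poly_Mapping.keys (g (Poly_Mapping.single x 1)))"
      by (auto simp: entry_def in_keys_iff)
  qed
  then show ?thesis using \<open>finite X\<close> by (auto intro: finite_subset)
qed

lemma underdetermined_system:
  fixes A :: "'x \<Rightarrow> 'q \<Rightarrow> 'k::field"
  assumes "finite Q" "finite X" "card Q < card X"
  shows "\<exists>c. (\<exists>x\<in>X. c x \<noteq> 0) \<and> (\<forall>q\<in>Q. (\<Sum>x\<in>X. c x * A x q) = 0)"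
  using assms
proof (induction Q arbitrary: X A rule: finite_induct)
  case empty
  then show ?case by (intro exI[of _ "\<lambda>_. 1"]) (auto simp: card_gt_0_iff)
next
  case (insert q Q)
  show ?case
  proof (cases "\<forall>x\<in>X. A x q = 0")
    case True
    have "card Q < card X" using insert by simp
    from insert.IH[OF insert.prems(1) this, of A] show ?thesis using True by auto
  next
    case False
    then obtain x0 where x0: "x0 \<in> X" "A x0 q \<noteq> 0" by blast
    define X' where "X' = X - {x0}"
    have X: "X = insert x0 X'" "x0 \<notin> X'" "finite X'" using x0 insert by (auto simp: X'_def)
    (* pivot at (x0, q): equation q determines the coefficient of x0 from the others *)
    define A' where "A' = (\<lambda>x r. A x r - A x q / A x0 q * A x0 r)"
    have "card Q < card X'" using insert X by simp
    from insert.IH[OF X(3) this, of A'] obtain c where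
      c: "\<exists>x\<in>X'. c x \<noteq> 0" "\<forall>r\<in>Q. (\<Sum>x\<in>X'. c x * A' x r) = 0" by blast
    define t where "t = - (\<Sum>x\<in>X'. c x * (A x q / A x0 q))"
    define d where "d = c(x0 := t)"
    have sum_d: "(\<Sum>x\<in>X. d x * A x r) = (\<Sum>x\<in>X'. c x * A' x r)" for r
    proof -
      have "(\<Sum>x\<in>X'. d x * A x r) = (\<Sum>x\<in>X'. c x * A x r)"
        using X(2) by (intro sum.cong) (auto simp: d_def)
      then show ?thesis using X
        by (simp add: d_def t_def A'_def right_diff_distrib sum_subtractf sum_distrib_right mult.assoc)
    qed
    have "(\<Sum>x\<in>X'. c x * A' x q) = 0" using x0 by (simp add: A'_def)
    then have "\<forall>r\<in>insert q Q. (\<Sum>x\<in>X. d x * A x r) = 0" using c sum_d by auto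
    moreover have "\<exists>x\<in>X. d x \<noteq> 0" using c(1) X by (auto simp: d_def)
    ultimately show ?thesis by blast
  qed
qed

text \<open>
  A vector supported on \<open>Z\<close> whose image vanishes on \<open>Q\<close> solves a homogeneous system of \<open>card Q\<close> equations
  in \<open>card Z\<close> unknowns.
\<close>

lemma card_le_if_determined:
  assumes h: "h \<in> module_hom Qu (free_space Z) (free_space V)"
    and "finite Z" "finite Q"
    and det: "\<And>v. Poly_Mapping.keys v \<subseteq> Z \<Longrightarrow> (\<And>q. q \<in> Q \<Longrightarrow> Poly_Mapping.lookup (h v) q = 0) \<Longrightarrow> v = 0"
  shows "card Z \<le> card Q"
proof (rule ccontr)
  assume "\<not> card Z \<le> card Q"
  then obtain c where c: "\<exists>x\<in>Z. c x \<noteq> 0" "\<forall>q\<in>Q. (\<Sum>x\<in>Z. c x * entry h x q) = 0"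
    using underdetermined_system[OF \<open>finite Q\<close> \<open>finite Z\<close>, of "entry h"] by auto
  define v where "v = (\<Sum>x\<in>Z. Poly_Mapping.single x (c x))"
  have "Poly_Mapping.lookup v k = (\<Sum>x\<in>Z. if x = k then c k else 0)" for k
    unfolding v_def lookup_sum by (rule sum.cong) (auto simp: lookup_single when_def)
  then have lookup_v: "Poly_Mapping.lookup v k = (if k \<in> Z then c k else 0)" for k
    using \<open>finite Z\<close> by simp
  then have "Poly_Mapping.keys v \<subseteq> Z" by (auto simp: in_keys_iff split: if_splits)
  moreover have "Poly_Mapping.lookup (h v) q = 0" if "q \<in> Q" for q
    using lookup_free_hom[OF h \<open>finite Z\<close> \<open>Poly_Mapping.keys v \<subseteq> Z\<close>] c(2) that lookup_v by simp
  ultimately have "v = 0" by (rule det)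
  then show False using c(1) lookup_v by (metis lookup_zero)
qed


section \<open>Products of operators that are weighted maps at the origin\<close>

definition weighted_map_at_0 ::
  "'x set \<Rightarrow> (('x \<Rightarrow>\<^sub>0 ratfun) \<Rightarrow> ('x \<Rightarrow>\<^sub>0 ratfun)) \<Rightarrow> ('x \<Rightarrow> 'x) \<Rightarrow> ('x \<Rightarrow> rat) \<Rightarrow> bool" where
  "weighted_map_at_0 X T f \<sigma> \<longleftrightarrow>
     (\<forall>x\<in>X. f x \<in> X \<and> (\<forall>y. reduces_to (entry T x y) (if y = f x then \<sigma> x else 0)))"

fun path_weight :: "('s \<Rightarrow> 'x \<Rightarrow> 'x) \<Rightarrow> ('s \<Rightarrow> 'x \<Rightarrow> rat) \<Rightarrow> 's list \<Rightarrow> 'x \<Rightarrow> rat" where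
  "path_weight f \<sigma> [] x = 1"
| "path_weight f \<sigma> (s # w) x = \<sigma> s x * path_weight f \<sigma> w (f s x)"

lemma path_weight_append:
  "path_weight f \<sigma> (v @ w) x = path_weight f \<sigma> v x * path_weight f \<sigma> w (fold f v x)"
  by (induction v arbitrary: x) auto

lemma free_hom_fold:
  assumes "\<And>s. s \<in> set w \<Longrightarrow> T s \<in> module_hom Qu (free_space X) (free_space X)"
  shows "fold T w \<in> module_hom Qu (free_space X) (free_space X)"
  using assms
proof (induction w)
  case Nil
  then show ?case by (simp add: free_hom_iff)
next
  case (Cons s w)
  then have "fold T w \<circ> T s \<in> module_hom Qu (free_space X) (free_space X)"
    by (intro free_hom_comp) auto
  then show ?case by (simp add: comp_def)
qed

lemma weighted_map_at_0_fold:
  assumes "finite X"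
    and "\<And>s. s \<in> set w \<Longrightarrow> T s \<in> module_hom Qu (free_space X) (free_space X)"
    and "\<And>s. s \<in> set w \<Longrightarrow> weighted_map_at_0 X (T s) (f s) (\<sigma> s)"
  shows "weighted_map_at_0 X (fold T w) (fold f w) (path_weight f \<sigma> w)"
  using assms(2,3)
proof (induction w)
  case Nil
  show ?case
    by (auto simp: weighted_map_at_0_def entry_def lookup_single when_def
        intro: reduces_to_0 reduces_to_1)
next
  case (Cons s w)
  have IH: "weighted_map_at_0 X (fold T w) (fold f w) (path_weight f \<sigma> w)"
    and s: "weighted_map_at_0 X (T s) (f s) (\<sigma> s)" using Cons by auto
  have hom: "T s \<in> module_hom Qu (free_space X) (free_space X)"
    "fold T w \<in> module_hom Qu (free_space X) (free_space X)"
    using Cons by (auto intro!: free_hom_fold)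
  show ?case unfolding weighted_map_at_0_def
  proof (intro ballI conjI allI)
    fix x z assume x: "x \<in> X"
    then have fx: "f s x \<in> X" using s by (simp add: weighted_map_at_0_def)
    then show "fold f (s # w) x \<in> X" using IH by (simp add: weighted_map_at_0_def)
    have "reduces_to (\<Sum>y\<in>X. entry (T s) x y * entry (fold T w) y z)
      (\<Sum>y\<in>X. (if y = f s x then \<sigma> s x else 0) *
                (if z = fold f w y then path_weight f \<sigma> w y else 0))"
      using IH s x by (intro reduces_to_sum reduces_to_mult) (auto simp: weighted_map_at_0_def)
    also have "(\<Sum>y\<in>X. (if y = f s x then \<sigma> s x else 0) *
                (if z = fold f w y then path_weight f \<sigma> w y else 0)) =
        (\<Sum>y\<in>X. if y = f s x then \<sigma> s x *
                (if z = fold f w (f s x) then path_weight f \<sigma> w (f s x) else 0) else 0)"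
      by (rule sum.cong) auto
    also have "\<dots> = (if z = fold f (s # w) x then path_weight f \<sigma> (s # w) x else 0)"
      using \<open>finite X\<close> fx by simp
    finally show "reduces_to (entry (fold T (s # w)) x z)
        (if z = fold f (s # w) x then path_weight f \<sigma> (s # w) x else 0)"
      using entry_comp[OF hom \<open>finite X\<close> x, of z] by (simp add: comp_def)
  qed
qed

lemma op_trace_reduces_to:
  assumes "weighted_map_at_0 X T f \<sigma>"
  shows "reduces_to (op_trace X T) (\<Sum>x\<in>X. if f x = x then \<sigma> x else 0)"
  unfolding op_trace_def
proof (rule reduces_to_sum)
  fix x assume "x \<in> X"
  then have "reduces_to (entry T x x) (if x = f x then \<sigma> x else 0)"
    using assms by (simp add: weighted_map_at_0_def)
  then show "reduces_to (entry T x x) (if f x = x then \<sigma> x else 0)"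
    by (simp add: eq_commute)
qed

text \<open>
  Two of the finitely many powers of \<open>f\<close> agree on \<open>V\<close>, so the powers are eventually periodic; an
  exponent that is a multiple of the period and past the preperiod gives an idempotent.
\<close>

lemma idempotent_power:
  assumes "finite V" and f: "\<And>x. x \<in> V \<Longrightarrow> f x \<in> V"
  obtains m :: nat where "m > 0" "\<And>x. x \<in> V \<Longrightarrow> (f ^^ m) ((f ^^ m) x) = (f ^^ m) x"
proof -
  have fV: "(f ^^ i) x \<in> V" if "x \<in> V" for i x using that f by (induction i) auto
  have "range (\<lambda>i. restrict (f ^^ i) V) \<subseteq> V \<rightarrow>\<^sub>E V" using fV by auto
  then have "finite (range (\<lambda>i. restrict (f ^^ i) V))"
    using \<open>finite V\<close> by (meson finite_PiE finite_subset)
  then have "\<not> inj (\<lambda>i. restrict (f ^^ i) V)" using finite_imageD by blast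
  then obtain k l where "k \<noteq> l" "restrict (f ^^ k) V = restrict (f ^^ l) V"
    unfolding inj_def by blast
  then obtain i j where "i < j" and "restrict (f ^^ i) V = restrict (f ^^ j) V"
    by (cases k l rule: linorder_cases) auto
  then have ij: "(f ^^ i) x = (f ^^ j) x" if "x \<in> V" for x
    using that by (metis restrict_apply')
  define d where "d = j - i"
  have period: "(f ^^ (n + k * d)) x = (f ^^ n) x" if "x \<in> V" "i \<le> n" for x n k
  proof (induction k)
    case (Suc k)
    have "n + Suc k * d = (n - i + k * d) + j" using \<open>i < j\<close> that by (simp add: d_def)
    then have "(f ^^ (n + Suc k * d)) x = (f ^^ (n - i + k * d)) ((f ^^ j) x)"
      by (metis comp_apply funpow_add)
    also have "\<dots> = (f ^^ (n - i + k * d)) ((f ^^ i) x)" using ij that by simp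
    also have "\<dots> = (f ^^ ((n - i + k * d) + i)) x" by (simp add: funpow_add)
    also have "(n - i + k * d) + i = n + k * d" using that by simp
    finally show ?case using Suc by simp
  qed simp
  define m where "m = Suc i * d"
  have "d > 0" using \<open>i < j\<close> by (simp add: d_def)
  then have "m > 0" "i \<le> m" unfolding m_def by (cases d; simp)+
  moreover have "(f ^^ m) ((f ^^ m) x) = (f ^^ m) x" if "x \<in> V" for x
    using period[OF that \<open>i \<le> m\<close>, of "Suc i"] unfolding m_def[symmetric]
    by (simp add: funpow_add)
  ultimately show thesis using that by blast
qed

lemma fold_concat_replicate: "fold f (concat (replicate m w)) = (fold f w) ^^ m"
  by (induction m) (auto simp: funpow_swap1 fun_eq_iff)


section \<open>The operators of a labeled digraph\<close>

definition edge_at :: "('v, 'e, 's) labeled_digraph \<Rightarrow> 's \<Rightarrow> 'v \<Rightarrow> 'e" where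
  "edge_at \<Gamma> s \<alpha> = (THE e. is_edge_at \<Gamma> s \<alpha> e)"

text \<open>The vertex where one ends up on following the edge labeled \<open>s\<close> if it leaves \<open>\<alpha>\<close>.\<close>

definition step :: "('v, 'e, 's) labeled_digraph \<Rightarrow> 's \<Rightarrow> 'v \<Rightarrow> 'v" where
  "step \<Gamma> s \<alpha> = head (multigraph \<Gamma>) (edge_at \<Gamma> s \<alpha>)"

locale labeled_digraph_over =
  fixes S :: "'s set" and \<Gamma> :: "('v, 'e, 's) labeled_digraph"
  assumes labeled: "S_labeled_digraph S \<Gamma>"
begin

sublocale loopfree_digraph "multigraph \<Gamma>"
  using labeled by (simp add: S_labeled_digraph_def)

lemma is_edge_at_edge_at:
  assumes "s \<in> S" "\<alpha> \<in> lverts \<Gamma>"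
  shows "is_edge_at \<Gamma> s \<alpha> (edge_at \<Gamma> s \<alpha>)"
proof -
  have "\<exists>!e. is_edge_at \<Gamma> s \<alpha> e" using labeled assms by (simp add: S_labeled_digraph_def)
  then show ?thesis unfolding edge_at_def by (rule theI')
qed

lemma edge_at_eq:
  assumes "s \<in> S" "\<alpha> \<in> lverts \<Gamma>" "is_edge_at \<Gamma> s \<alpha> e"
  shows "edge_at \<Gamma> s \<alpha> = e"
proof -
  have "\<exists>!e. is_edge_at \<Gamma> s \<alpha> e" using labeled assms by (simp add: S_labeled_digraph_def)
  then show ?thesis using is_edge_at_edge_at assms by blast
qed

lemma tau_vec_edge_at:
  assumes "edge_at \<Gamma> s \<alpha> = e"
  shows "tau_vec \<Gamma> s \<alpha> =
    (if tail (multigraph \<Gamma>) e = \<alpha>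
     then (if \<not> dashed \<Gamma> e then Poly_Mapping.single (head (multigraph \<Gamma>) e) 1
           else Poly_Mapping.single \<alpha> rf_u +
                Poly_Mapping.single (head (multigraph \<Gamma>) e) (rf_u + 1))
     else (if \<not> dashed \<Gamma> e
           then Poly_Mapping.single \<alpha> (rf_u\<^sup>2 - 1) +
                Poly_Mapping.single (tail (multigraph \<Gamma>) e) (rf_u\<^sup>2)
           else Poly_Mapping.single \<alpha> (rf_u\<^sup>2 - rf_u - 1) +
                Poly_Mapping.single (tail (multigraph \<Gamma>) e) (rf_u\<^sup>2 - rf_u)))"
  unfolding tau_vec_def edge_at_def[symmetric] assms Let_def by simp

lemma step_in_verts:
  assumes "s \<in> S" "\<alpha> \<in> lverts \<Gamma>"
  shows "step \<Gamma> s \<alpha> \<in> lverts \<Gamma>"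
  using is_edge_at_edge_at[OF assms] by (auto simp: step_def is_edge_at_def)

lemma fold_step_in_verts:
  assumes "set w \<subseteq> S" "\<alpha> \<in> lverts \<Gamma>"
  shows "fold (step \<Gamma>) w \<alpha> \<in> lverts \<Gamma>"
  using assms by (induction w arbitrary: \<alpha>) (auto intro: step_in_verts)

lemma step_tail:
  assumes "e \<in> arcs (multigraph \<Gamma>)"
  shows "step \<Gamma> (label \<Gamma> e) (tail (multigraph \<Gamma>) e) = head (multigraph \<Gamma>) e"
proof -
  have "label \<Gamma> e \<in> S" using labeled assms by (simp add: S_labeled_digraph_def)
  moreover have "is_edge_at \<Gamma> (label \<Gamma> e) (tail (multigraph \<Gamma>) e) e"
    using assms by (simp add: is_edge_at_def)
  ultimately show ?thesis
    using edge_at_eq tail_in_verts[OF assms] by (simp add: step_def)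
qed

lemma fold_step_awalk:
  assumes "awalk \<alpha> p \<beta>"
  shows "fold (step \<Gamma>) (map (label \<Gamma>) p) \<alpha> = \<beta>"
  using assms
  by (induction p arbitrary: \<alpha>) (auto simp: awalk_Nil_iff awalk_Cons_iff step_tail)

lemma entry_tau:
  assumes "\<alpha> \<in> lverts \<Gamma>"
  shows "entry (tau \<Gamma> s) \<alpha> \<beta> = Poly_Mapping.lookup (tau_vec \<Gamma> s \<alpha>) \<beta>"
  using assms by (simp add: entry_def tau_def linear_extension_def)

definition step_sign :: "'s \<Rightarrow> 'v \<Rightarrow> rat" where
  "step_sign s \<alpha> = (if step \<Gamma> s \<alpha> = \<alpha> then - 1 else 1)"

text \<open>
  At \<open>u = 0\<close> solid and dashed edges can no longer be told apart: \<open>\<tau>\<^sub>s\<close> sends the tail of an edge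
  labeled \<open>s\<close> to its head, and the head to minus itself.
\<close>

lemma weighted_map_at_0_tau:
  assumes s: "s \<in> S"
  shows "weighted_map_at_0 (lverts \<Gamma>) (tau \<Gamma> s) (step \<Gamma> s) (step_sign s)"
  unfolding weighted_map_at_0_def
proof (intro ballI conjI allI)
  fix \<alpha> \<beta> assume \<alpha>: "\<alpha> \<in> lverts \<Gamma>"
  then show "step \<Gamma> s \<alpha> \<in> lverts \<Gamma>" by (rule step_in_verts[OF s])
  define e where "e = edge_at \<Gamma> s \<alpha>"
  have e: "is_edge_at \<Gamma> s \<alpha> e" using is_edge_at_edge_at[OF s \<alpha>] by (simp add: e_def)
  have ne: "tail (multigraph \<Gamma>) e \<noteq> head (multigraph \<Gamma>) e"
    using e no_loops by (auto simp: is_edge_at_def)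
  have u1: "reduces_to (rf_u + 1) 1"
    using reduces_to_add[OF reduces_to_u reduces_to_1] by simp
  have u2: "reduces_to (rf_u\<^sup>2) 0" using reduces_to_power[OF reduces_to_u, of 2] by simp
  have u3: "reduces_to (rf_u\<^sup>2 - 1) (- 1)" using reduces_to_diff[OF u2 reduces_to_1] by simp
  have u4: "reduces_to (rf_u\<^sup>2 - rf_u) 0" using reduces_to_diff[OF u2 reduces_to_u] by simp
  have u5: "reduces_to (rf_u\<^sup>2 - rf_u - 1) (- 1)" using reduces_to_diff[OF u4 reduces_to_1] by simp
  note red = reduces_to_0 reduces_to_1 reduces_to_u u1 u2 u3 u4 u5
  have "reduces_to (Poly_Mapping.lookup (tau_vec \<Gamma> s \<alpha>) \<beta>)
      (if \<beta> = head (multigraph \<Gamma>) e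
       then (if head (multigraph \<Gamma>) e = \<alpha> then - 1 else 1) else 0)"
    using e ne red
    by (auto simp: tau_vec_edge_at[OF e_def[symmetric]] lookup_single lookup_add when_def
        is_edge_at_def)
  moreover have "head (multigraph \<Gamma>) e = step \<Gamma> s \<alpha>" by (simp add: step_def e_def)
  ultimately show "reduces_to (entry (tau \<Gamma> s) \<alpha> \<beta>)
      (if \<beta> = step \<Gamma> s \<alpha> then step_sign s \<alpha> else 0)"
    by (simp only: entry_tau[OF \<alpha>] step_sign_def)
qed

lemma path_weight_step_sign: "(path_weight (step \<Gamma>) step_sign w \<alpha>)\<^sup>2 = 1"
  by (induction w arbitrary: \<alpha>) (auto simp: power_mult_distrib step_sign_def)

text \<open>
  On the edge with tail \<open>\<alpha>\<close> and head \<open>\<beta>\<close>, the eigenvalue \<open>-1\<close> of \<open>\<tau>\<^sub>s\<close> belongs to the vector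
  \<open>\<beta> - u\<^sup>2 \<alpha>\<close> if the edge is solid and to \<open>(u + 1) \<beta> - (u\<^sup>2 - u) \<alpha>\<close> if it is dashed. In both cases
  the coefficient at the tail is that at the head times a function vanishing at \<open>u = 0\<close>.
\<close>

lemma sign_vector_step:
  assumes s: "s \<in> S" and \<alpha>: "\<alpha> \<in> lverts \<Gamma>" and fin: "finite (lverts \<Gamma>)"
    and hom: "tau \<Gamma> s \<in> module_hom Qu (free_space (lverts \<Gamma>)) (free_space (lverts \<Gamma>))"
    and v: "Poly_Mapping.keys v \<subseteq> lverts \<Gamma>" and eig: "tau \<Gamma> s v = scl (- 1) v"
  obtains c where "Poly_Mapping.lookup v \<alpha> = c * Poly_Mapping.lookup v (step \<Gamma> s \<alpha>)"
    and "step \<Gamma> s \<alpha> = \<alpha> \<or> reduces_to c 0"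
proof (cases "step \<Gamma> s \<alpha> = \<alpha>")
  case True
  then show thesis using that[of 1] by simp
next
  case False
  define e where "e = edge_at \<Gamma> s \<alpha>"
  define \<beta> where "\<beta> = head (multigraph \<Gamma>) e"
  have e: "is_edge_at \<Gamma> s \<alpha> e" using is_edge_at_edge_at[OF s \<alpha>] by (simp add: e_def)
  have \<beta>: "step \<Gamma> s \<alpha> = \<beta>" by (simp add: step_def e_def \<beta>_def)
  then have tail: "tail (multigraph \<Gamma>) e = \<alpha>" and ne: "\<beta> \<noteq> \<alpha>"
    using e False by (auto simp: is_edge_at_def \<beta>_def)
  have \<beta>V: "\<beta> \<in> lverts \<Gamma>" using step_in_verts[OF s \<alpha>] \<beta> by simp
  have "is_edge_at \<Gamma> s \<beta> e" using e by (auto simp: is_edge_at_def \<beta>_def)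
  then have edge_\<beta>: "edge_at \<Gamma> s \<beta> = e" by (rule edge_at_eq[OF s \<beta>V])
  have other: "Poly_Mapping.lookup (tau_vec \<Gamma> s \<gamma>) \<beta> = 0"
    if \<gamma>: "\<gamma> \<in> lverts \<Gamma>" "\<gamma> \<notin> {\<alpha>, \<beta>}" for \<gamma>
  proof -
    define e' where "e' = edge_at \<Gamma> s \<gamma>"
    have e': "is_edge_at \<Gamma> s \<gamma> e'" using is_edge_at_edge_at[OF s \<gamma>(1)] by (simp add: e'_def)
    have "\<beta> \<noteq> tail (multigraph \<Gamma>) e' \<and> \<beta> \<noteq> head (multigraph \<Gamma>) e'"
    proof (rule ccontr)
      assume "\<not> ?thesis"
      then have "is_edge_at \<Gamma> s \<beta> e'" using e' by (auto simp: is_edge_at_def)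
      then have "e' = e" using edge_at_eq[OF s \<beta>V] edge_\<beta> by simp
      then show False using e' \<gamma>(2) tail by (auto simp: is_edge_at_def \<beta>_def)
    qed
    then show ?thesis using \<gamma>
      by (auto simp: tau_vec_edge_at[OF e'_def[symmetric]] lookup_single lookup_add when_def)
  qed
  have "Poly_Mapping.lookup (tau \<Gamma> s v) \<beta> =
      (\<Sum>\<gamma>\<in>lverts \<Gamma>. Poly_Mapping.lookup v \<gamma> * entry (tau \<Gamma> s) \<gamma> \<beta>)"
    by (rule lookup_free_hom[OF hom fin v])
  also have "\<dots> = (\<Sum>\<gamma>\<in>{\<alpha>, \<beta>}. Poly_Mapping.lookup v \<gamma> * entry (tau \<Gamma> s) \<gamma> \<beta>)"
    using \<alpha> \<beta>V fin other by (intro sum.mono_neutral_right) (auto simp: entry_tau)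
  also have "\<dots> = Poly_Mapping.lookup v \<alpha> * Poly_Mapping.lookup (tau_vec \<Gamma> s \<alpha>) \<beta> +
      Poly_Mapping.lookup v \<beta> * Poly_Mapping.lookup (tau_vec \<Gamma> s \<beta>) \<beta>"
    using ne \<alpha> \<beta>V by (simp add: entry_tau)
  finally have eq: "Poly_Mapping.lookup v \<alpha> * Poly_Mapping.lookup (tau_vec \<Gamma> s \<alpha>) \<beta> +
      Poly_Mapping.lookup v \<beta> * Poly_Mapping.lookup (tau_vec \<Gamma> s \<beta>) \<beta> =
      - Poly_Mapping.lookup v \<beta>"
    using eig by simp
  note unfold_tau = tau_vec_edge_at[OF e_def[symmetric]] tau_vec_edge_at[OF edge_\<beta>]
    lookup_single lookup_add when_def tail \<beta>_def[symmetric]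
  have u2: "reduces_to (rf_u\<^sup>2) 0" using reduces_to_power[OF reduces_to_u, of 2] by simp
  show thesis
  proof (cases "dashed \<Gamma> e")
    case False
    then have "Poly_Mapping.lookup (tau_vec \<Gamma> s \<alpha>) \<beta> = 1"
      "Poly_Mapping.lookup (tau_vec \<Gamma> s \<beta>) \<beta> = rf_u\<^sup>2 - 1"
      using ne by (simp_all add: unfold_tau)
    note eq[unfolded this]
    moreover have "Poly_Mapping.lookup v \<alpha> = (Poly_Mapping.lookup v \<alpha> * 1 +
        Poly_Mapping.lookup v \<beta> * (rf_u\<^sup>2 - 1)) +
        Poly_Mapping.lookup v \<beta> - rf_u\<^sup>2 * Poly_Mapping.lookup v \<beta>"
      by (simp add: algebra_simps)
    ultimately have "Poly_Mapping.lookup v \<alpha> = - (rf_u\<^sup>2) * Poly_Mapping.lookup v \<beta>"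
      by simp
    moreover have "reduces_to (- (rf_u\<^sup>2)) 0" using reduces_to_uminus[OF u2] by simp
    ultimately show thesis using that \<beta> by blast
  next
    case True
    then have "Poly_Mapping.lookup (tau_vec \<Gamma> s \<alpha>) \<beta> = rf_u + 1"
      "Poly_Mapping.lookup (tau_vec \<Gamma> s \<beta>) \<beta> = rf_u\<^sup>2 - rf_u - 1"
      using ne by (simp_all add: unfold_tau)
    note eq[unfolded this]
    moreover have "Poly_Mapping.lookup v \<alpha> * (rf_u + 1) = (Poly_Mapping.lookup v \<alpha> * (rf_u + 1) +
        Poly_Mapping.lookup v \<beta> * (rf_u\<^sup>2 - rf_u - 1)) +
        Poly_Mapping.lookup v \<beta> + (rf_u - rf_u\<^sup>2) * Poly_Mapping.lookup v \<beta>"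
      by (simp add: algebra_simps)
    ultimately have 1: "Poly_Mapping.lookup v \<alpha> * (rf_u + 1) =
        (rf_u - rf_u\<^sup>2) * Poly_Mapping.lookup v \<beta>"
      by simp
    have red: "reduces_to (rf_u + 1) 1"
      using reduces_to_add[OF reduces_to_u reduces_to_1] by simp
    then have "rf_u + 1 \<noteq> 0" using reduces_to_unique[OF _ reduces_to_0] by fastforce
    then have "Poly_Mapping.lookup v \<alpha> =
        (rf_u - rf_u\<^sup>2) * inverse (rf_u + 1) * Poly_Mapping.lookup v \<beta>"
      using 1 by (simp add: field_simps)
    moreover have "reduces_to ((rf_u - rf_u\<^sup>2) * inverse (rf_u + 1)) 0"
      using reduces_to_mult[OF reduces_to_diff[OF reduces_to_u u2] reduces_to_inverse[OF red]]
      by simp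
    ultimately show thesis using that \<beta> by blast
  qed
qed

lemma sign_vector_fold_step:
  assumes w: "set w \<subseteq> S" and \<alpha>: "\<alpha> \<in> lverts \<Gamma>" and fin: "finite (lverts \<Gamma>)"
    and hom: "\<And>s. s \<in> set w \<Longrightarrow>
      tau \<Gamma> s \<in> module_hom Qu (free_space (lverts \<Gamma>)) (free_space (lverts \<Gamma>))"
    and v: "Poly_Mapping.keys v \<subseteq> lverts \<Gamma>"
    and eig: "\<And>s. s \<in> set w \<Longrightarrow> tau \<Gamma> s v = scl (- 1) v"
  obtains c where "Poly_Mapping.lookup v \<alpha> = c * Poly_Mapping.lookup v (fold (step \<Gamma>) w \<alpha>)"
    and "(\<forall>s\<in>set w. step \<Gamma> s \<alpha> = \<alpha>) \<or> reduces_to c 0"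
proof -
  (* c = 1 in the stationary case, so that prefixing an edge still gives c a value at u = 0 *)
  have "\<exists>c. Poly_Mapping.lookup v \<alpha> = c * Poly_Mapping.lookup v (fold (step \<Gamma>) w \<alpha>) \<and>
      (if \<forall>s\<in>set w. step \<Gamma> s \<alpha> = \<alpha> then c = 1 else reduces_to c 0)"
    using w \<alpha> hom eig
  proof (induction w arbitrary: \<alpha>)
    case Nil
    then show ?case by simp
  next
    case (Cons s w)
    define \<beta> where "\<beta> = step \<Gamma> s \<alpha>"
    have s: "s \<in> S" and \<beta>: "\<beta> \<in> lverts \<Gamma>" using Cons.prems step_in_verts by (auto simp: \<beta>_def)
    obtain d where d: "Poly_Mapping.lookup v \<beta> = d * Poly_Mapping.lookup v (fold (step \<Gamma>) w \<beta>)"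
      "if \<forall>s\<in>set w. step \<Gamma> s \<beta> = \<beta> then d = 1 else reduces_to d 0"
      using Cons.IH[OF _ \<beta>] Cons.prems by auto
    show ?case
    proof (cases "\<beta> = \<alpha>")
      case True
      then show ?thesis using d by (intro exI[of _ d]) (auto simp: \<beta>_def)
    next
      case False
      obtain c where c: "Poly_Mapping.lookup v \<alpha> = c * Poly_Mapping.lookup v \<beta>" "reduces_to c 0"
      proof (rule sign_vector_step[OF s \<open>\<alpha> \<in> lverts \<Gamma>\<close> fin _ v])
        show "tau \<Gamma> s \<in> module_hom Qu (free_space (lverts \<Gamma>)) (free_space (lverts \<Gamma>))"
          "tau \<Gamma> s v = scl (- 1) v" using Cons.prems by auto
      qed (use False in \<open>auto simp: \<beta>_def\<close>)
      obtain r where "reduces_to d r" using d(2) reduces_to_1 by (auto split: if_splits)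
      then have "reduces_to (c * d) 0" using reduces_to_mult[OF c(2)] by fastforce
      moreover have "Poly_Mapping.lookup v \<alpha> =
          (c * d) * Poly_Mapping.lookup v (fold (step \<Gamma>) (s # w) \<alpha>)"
        using c(1) d(1) by (simp add: \<beta>_def)
      moreover have "\<not> (\<forall>s'\<in>set (s # w). step \<Gamma> s' \<alpha> = \<alpha>)" using False by (simp add: \<beta>_def)
      ultimately show ?thesis by (intro exI[of _ "c * d"]) (simp only: if_False simp_thms)
    qed
  qed
  then show thesis using that by metis
qed

end


section \<open>The operators of a \<open>W\<close>-graph\<close>

definition descent_sign :: "('x, 's) wgraph \<Rightarrow> 's \<Rightarrow> 'x \<Rightarrow> rat" where
  "descent_sign \<Psi> s x = (if s \<in> wI \<Psi> x then - 1 else 0)"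

lemma entry_wgraph_op:
  assumes "x \<in> wverts \<Psi>"
  shows "entry (wgraph_op \<Psi> s) x y = Poly_Mapping.lookup (wgraph_vec \<Psi> s x) y"
  using assms by (simp add: entry_def wgraph_op_def linear_extension_def)

lemma weighted_map_at_0_wgraph_op:
  "weighted_map_at_0 (wverts \<Psi>) (wgraph_op \<Psi> s) (\<lambda>x. x) (descent_sign \<Psi> s)"
  unfolding weighted_map_at_0_def
proof (intro ballI conjI allI)
  fix x y assume x: "x \<in> wverts \<Psi>"
  show "reduces_to (entry (wgraph_op \<Psi> s) x y) (if y = x then descent_sign \<Psi> s x else 0)"
  proof (cases "s \<in> wI \<Psi> x")
    case True
    then show ?thesis using reduces_to_0 reduces_to_uminus[OF reduces_to_1]
      by (auto simp: entry_wgraph_op[OF x] wgraph_vec_def descent_sign_def lookup_single when_def)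
  next
    case False
    have "reduces_to (Poly_Mapping.lookup (Poly_Mapping.single z (rf_const q)) y)
        (if z = y then q else 0)" for z and q :: rat
      using reduces_to_const reduces_to_0 by (simp add: lookup_single when_def)
    then have "reduces_to (\<Sum>z\<in>wgraph_nbrs \<Psi> s x.
          Poly_Mapping.lookup (Poly_Mapping.single z (rf_const (wmu \<Psi> z x))) y)
        (\<Sum>z\<in>wgraph_nbrs \<Psi> s x. if z = y then wmu \<Psi> z x else 0)"
      by (intro reduces_to_sum)
    from reduces_to_mult[OF reduces_to_u this]
    have "reduces_to (rf_u * (\<Sum>z\<in>wgraph_nbrs \<Psi> s x.
        Poly_Mapping.lookup (Poly_Mapping.single z (rf_const (wmu \<Psi> z x))) y)) 0"
      by simp
    moreover have "reduces_to (Poly_Mapping.lookup (Poly_Mapping.single x (rf_u\<^sup>2)) y) 0"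
      using reduces_to_power[OF reduces_to_u, of 2] reduces_to_0
      by (simp add: lookup_single when_def)
    ultimately have "reduces_to (Poly_Mapping.lookup (wgraph_vec \<Psi> s x) y) 0"
      using False reduces_to_add by (fastforce simp: wgraph_vec_def lookup_add lookup_sum)
    then show ?thesis using False by (auto simp: entry_wgraph_op[OF x] descent_sign_def)
  qed
qed auto

lemma fold_stay: "fold (\<lambda>_ x. x) w x = x"
  by (induction w) auto

lemma path_weight_descent_sign:
  "(path_weight (\<lambda>_ x. x) (descent_sign \<Psi>) w x)\<^sup>2 = (if set w \<subseteq> wI \<Psi> x then 1 else 0)"
  by (induction w) (auto simp: power_mult_distrib descent_sign_def)

section \<open>Comparing the two modules\<close>

lemma op_hom:
  assumes T: "T s \<in> carrier H" and op: "extends_to_action S H T M op \<phi>" and s: "s \<in> S"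
  shows "op s \<in> module_hom Qu M M"
proof -
  have "\<phi> \<in> module_hom Qu H (End_alg Qu M)"
    using op by (simp add: extends_to_action_def algebra_hom_def)
  then have "\<phi> (T s) \<in> carrier (End_alg Qu M)"
    using module_hom_closed T by blast
  then show ?thesis using op s by (simp add: extends_to_action_def End_alg_def)
qed

text \<open>
  The products of the operators along \<open>w w\<close> are conjugate by \<open>g\<close> and so have the same trace. At
  \<open>u = 0\<close> its two expressions are sums over the fixed points of \<open>f\<^sub>w\<close> and over the vertices \<open>x\<close> of
  the \<open>W\<close>-graph in which all letters of \<open>w\<close> belong to \<open>I\<^sub>x\<close>. The word is doubled because then each
  term is the square of a sign, so that the sums are plain cardinalities.
\<close>

lemma card_fixed_points_eq:
  fixes \<Gamma> :: "('v, 'e, 's) labeled_digraph" and \<Psi> :: "('x, 's) wgraph"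
  assumes \<Gamma>: "S_labeled_digraph S \<Gamma>" and finV: "finite (lverts \<Gamma>)"
    and finX: "finite (wverts \<Psi>)" and w: "set w \<subseteq> S"
    and tau: "\<And>s. s \<in> S \<Longrightarrow> tau \<Gamma> s \<in> module_hom Qu (digraph_space \<Gamma>) (digraph_space \<Gamma>)"
    and wop: "\<And>s. s \<in> S \<Longrightarrow> wgraph_op \<Psi> s \<in> module_hom Qu (wgraph_space \<Psi>) (wgraph_space \<Psi>)"
    and g: "g \<in> module_hom Qu (digraph_space \<Gamma>) (wgraph_space \<Psi>)"
    and bij: "bij_betw g (carrier (digraph_space \<Gamma>)) (carrier (wgraph_space \<Psi>))"
    and comm: "\<And>s v. s \<in> S \<Longrightarrow> v \<in> carrier (digraph_space \<Gamma>) \<Longrightarrow>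
      g (tau \<Gamma> s v) = wgraph_op \<Psi> s (g v)"
    and idem: "\<And>\<alpha>. \<alpha> \<in> lverts \<Gamma> \<Longrightarrow>
      fold (step \<Gamma>) w (fold (step \<Gamma>) w \<alpha>) = fold (step \<Gamma>) w \<alpha>"
  shows "card {\<alpha> \<in> lverts \<Gamma>. fold (step \<Gamma>) w \<alpha> = \<alpha>} = card {x \<in> wverts \<Psi>. set w \<subseteq> wI \<Psi> x}"
proof -
  interpret labeled_digraph_over S \<Gamma> using \<Gamma> by unfold_locales
  note spaces = digraph_space_def wgraph_space_def
  define h where "h = inv_into (carrier (digraph_space \<Gamma>)) g"
  have h: "h \<in> module_hom Qu (wgraph_space \<Psi>) (digraph_space \<Gamma>)"
    using free_hom_inv g bij unfolding spaces h_def by blast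
  define A where "A = fold (tau \<Gamma>) (w @ w)"
  define B where "B = fold (wgraph_op \<Psi>) (w @ w)"
  have A: "A \<in> module_hom Qu (digraph_space \<Gamma>) (digraph_space \<Gamma>)"
    unfolding A_def digraph_space_def using tau w by (intro free_hom_fold) (auto simp: spaces)
  have comm_fold: "g (fold (tau \<Gamma>) v x) = fold (wgraph_op \<Psi>) v (g x)"
    if "set v \<subseteq> S" "x \<in> carrier (digraph_space \<Gamma>)" for v x
    using that
  proof (induction v arbitrary: x)
    case (Cons s v)
    then have "tau \<Gamma> s x \<in> carrier (digraph_space \<Gamma>)"
      using module_hom_closed[OF tau] by auto
    then show ?case using Cons comm by simp
  qed simp
  have "op_trace (lverts \<Gamma>) A = op_trace (lverts \<Gamma>) (h \<circ> (g \<circ> A))"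
    unfolding op_trace_def
  proof (rule sum.cong)
    fix \<alpha> assume "\<alpha> \<in> lverts \<Gamma>"
    then have "A (Poly_Mapping.single \<alpha> 1) \<in> carrier (digraph_space \<Gamma>)"
      using A by (auto simp: free_hom_iff spaces)
    then have "h (g (A (Poly_Mapping.single \<alpha> 1))) = A (Poly_Mapping.single \<alpha> 1)"
      unfolding h_def by (rule bij_betw_inv_into_left[OF bij])
    then show "entry A \<alpha> \<alpha> = entry (h \<circ> (g \<circ> A)) \<alpha> \<alpha>" by (simp add: entry_def)
  qed simp
  also have "\<dots> = op_trace (wverts \<Psi>) ((g \<circ> A) \<circ> h)"
    using A g h finV finX unfolding spaces
    by (intro op_trace_comp_commute free_hom_comp) auto
  also have "\<dots> = op_trace (wverts \<Psi>) B"
    unfolding op_trace_def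
  proof (rule sum.cong)
    fix x assume "x \<in> wverts \<Psi>"
    then have x: "Poly_Mapping.single x 1 \<in> carrier (wgraph_space \<Psi>)"
      by (simp add: spaces)
    then have "h (Poly_Mapping.single x 1) \<in> carrier (digraph_space \<Gamma>)"
      using module_hom_closed[OF h] by auto
    then have "g (A (h (Poly_Mapping.single x 1))) = B (g (h (Poly_Mapping.single x 1)))"
      unfolding A_def B_def using w by (intro comm_fold) auto
    also have "\<dots> = B (Poly_Mapping.single x 1)"
      using bij_betw_inv_into_right[OF bij x] by (simp add: h_def)
    finally show "entry ((g \<circ> A) \<circ> h) x x = entry B x x" by (simp add: entry_def)
  qed simp
  finally have trace_eq: "op_trace (lverts \<Gamma>) A = op_trace (wverts \<Psi>) B" .

  let ?f = "fold (step \<Gamma>) w"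
  have "weighted_map_at_0 (lverts \<Gamma>) A (fold (step \<Gamma>) (w @ w))
      (path_weight (step \<Gamma>) step_sign (w @ w))"
    unfolding A_def using finV w tau
    by (intro weighted_map_at_0_fold weighted_map_at_0_tau) (auto simp: spaces)
  then have "reduces_to (op_trace (lverts \<Gamma>) A) (\<Sum>\<alpha>\<in>lverts \<Gamma>.
      if fold (step \<Gamma>) (w @ w) \<alpha> = \<alpha> then path_weight (step \<Gamma>) step_sign (w @ w) \<alpha> else 0)"
    by (rule op_trace_reduces_to)
  also have "\<dots> = (\<Sum>\<alpha>\<in>lverts \<Gamma>. if ?f \<alpha> = \<alpha> then 1 else 0)"
    using idem path_weight_step_sign[of w]
    by (intro sum.cong) (auto simp: path_weight_append power2_eq_square)
  also have "\<dots> = of_nat (card {\<alpha> \<in> lverts \<Gamma>. ?f \<alpha> = \<alpha>})"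
    using finV by (simp add: sum.If_cases Int_def)
  finally have red_A: "reduces_to (op_trace (lverts \<Gamma>) A) \<dots>" .

  have "weighted_map_at_0 (wverts \<Psi>) B (fold (\<lambda>_ x. x) (w @ w))
      (path_weight (\<lambda>_ x. x) (descent_sign \<Psi>) (w @ w))"
    unfolding B_def using finX w wop
    by (intro weighted_map_at_0_fold weighted_map_at_0_wgraph_op) (auto simp: spaces)
  then have "reduces_to (op_trace (wverts \<Psi>) B) (\<Sum>x\<in>wverts \<Psi>.
      if fold (\<lambda>_ x. x) (w @ w) x = x
      then path_weight (\<lambda>_ x. x) (descent_sign \<Psi>) (w @ w) x else 0)"
    by (rule op_trace_reduces_to)
  also have "\<dots> = (\<Sum>x\<in>wverts \<Psi>. if set w \<subseteq> wI \<Psi> x then 1 else 0)"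
    using path_weight_descent_sign[of \<Psi> w]
    by (intro sum.cong) (auto simp: path_weight_append power2_eq_square fold_stay)
  also have "\<dots> = of_nat (card {x \<in> wverts \<Psi>. set w \<subseteq> wI \<Psi> x})"
    using finX by (simp add: sum.If_cases Int_def)
  finally have "reduces_to (op_trace (lverts \<Gamma>) A) (of_nat (card {x \<in> wverts \<Psi>. set w \<subseteq> wI \<Psi> x}))"
    unfolding trace_eq .
  from reduces_to_unique[OF red_A this] show ?thesis by (rule of_nat_eq_iff[THEN iffD1])
qed

theorem theorem1p12:
  fixes G :: "('a, 'b) monoid_scheme"
    and S :: "'a set"
    and n :: "'a \<Rightarrow> 'a \<Rightarrow> enat"
    and H :: "(ratfun, 'h) module"
    and T :: "'a \<Rightarrow> 'h"
    and \<Gamma> :: "('v, 'e, 'a) labeled_digraph"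
    and \<phi> :: "'h \<Rightarrow> ('v \<Rightarrow>\<^sub>0 ratfun) \<Rightarrow> ('v \<Rightarrow>\<^sub>0 ratfun)"
    and \<Psi> :: "('x, 'a) wgraph"
  assumes "coxeter_system G S n"
    and "hecke_algebra G S H T"
    and "\<And>J. J \<subset> S \<Longrightarrow> finite (generate G J)"
    and "W_digraph S H T \<Gamma>"
    and "finite (lverts \<Gamma>)"
    and "connected_digraph \<Gamma>"
    and "extends_to_action S H T (digraph_space \<Gamma>) (tau \<Gamma>) \<phi>"
    and "affords S H T (digraph_space \<Gamma>) \<phi> \<Psi>"
  shows "acyclic_digraph \<Gamma>"
proof (rule ccontr)
  assume "\<not> acyclic_digraph \<Gamma>"
  note finV = \<open>finite (lverts \<Gamma>)\<close>
  have labeled: "S_labeled_digraph S \<Gamma>" using \<open>W_digraph S H T \<Gamma>\<close> by (simp add: W_digraph_def)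
  then interpret labeled_digraph_over S \<Gamma> by unfold_locales
  note spaces = digraph_space_def wgraph_space_def

  have "S \<subseteq> carrier G"
    using \<open>coxeter_system G S n\<close> by (simp add: coxeter_system_def has_presentation_def)
  moreover have "T ` carrier G \<subseteq> carrier H"
  proof -
    have "vectorspace Qu H" "vectorspace.basis Qu H (T ` carrier G)"
      using \<open>hecke_algebra G S H T\<close> unfolding hecke_algebra_def assoc_algebra_def by blast+
    then show ?thesis by (simp add: vectorspace.basis_def)
  qed
  ultimately have T: "T s \<in> carrier H" if "s \<in> S" for s using that by auto
  obtain \<psi> g where \<psi>: "extends_to_action S H T (wgraph_space \<Psi>) (wgraph_op \<Psi>) \<psi>"
    and g: "g \<in> module_hom Qu (digraph_space \<Gamma>) (wgraph_space \<Psi>)"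
    and bij: "bij_betw g (carrier (digraph_space \<Gamma>)) (carrier (wgraph_space \<Psi>))"
    and g_\<phi>: "\<And>a v. a \<in> carrier H \<Longrightarrow> v \<in> carrier (digraph_space \<Gamma>) \<Longrightarrow> g (\<phi> a v) = \<psi> a (g v)"
    using \<open>affords S H T (digraph_space \<Gamma>) \<phi> \<Psi>\<close> unfolding affords_def H_isomorphic_def by blast
  have tau: "tau \<Gamma> s \<in> module_hom Qu (digraph_space \<Gamma>) (digraph_space \<Gamma>)" if "s \<in> S" for s
    using op_hom T that \<open>extends_to_action S H T (digraph_space \<Gamma>) (tau \<Gamma>) \<phi>\<close> by metis
  have wop: "wgraph_op \<Psi> s \<in> module_hom Qu (wgraph_space \<Psi>) (wgraph_space \<Psi>)" if "s \<in> S" for s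
    using op_hom T that \<psi> by metis
  have comm: "g (tau \<Gamma> s v) = wgraph_op \<Psi> s (g v)"
    if "s \<in> S" "v \<in> carrier (digraph_space \<Gamma>)" for s v
    using g_\<phi>[OF T] that \<psi> \<open>extends_to_action S H T (digraph_space \<Gamma>) (tau \<Gamma>) \<phi>\<close>
    by (metis extends_to_action_def)
  have finX: "finite (wverts \<Psi>)"
    using free_hom_surj_finite g bij_betw_imp_surj_on[OF bij] finV unfolding spaces by blast

  obtain p \<alpha>0 where p: "awalk \<alpha>0 p \<alpha>0" "p \<noteq> []"
    using \<open>\<not> acyclic_digraph \<Gamma>\<close> by (auto simp: acyclic_digraph_def closed_w_def)
  then have \<alpha>0: "\<alpha>0 \<in> lverts \<Gamma>" and p_arcs: "set p \<subseteq> arcs (multigraph \<Gamma>)"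
    by (auto simp: awalk_def)
  define w where "w = map (label \<Gamma>) p"
  have wS: "set w \<subseteq> S" using labeled p_arcs by (auto simp: w_def S_labeled_digraph_def)
  have fixed: "fold (step \<Gamma>) w \<alpha>0 = \<alpha>0" unfolding w_def using p(1) by (rule fold_step_awalk)
  have moved: "\<not> (\<forall>s\<in>set w. step \<Gamma> s \<alpha>0 = \<alpha>0)"
  proof -
    obtain e q where "p = e # q" using p(2) by (cases p) auto
    then have e: "e \<in> arcs (multigraph \<Gamma>)" "tail (multigraph \<Gamma>) e = \<alpha>0" "label \<Gamma> e \<in> set w"
      using p(1) by (auto simp: awalk_Cons_iff w_def)
    then show ?thesis using step_tail[OF e(1)] no_loops[OF e(1)] by metis
  qed

  obtain m where m: "m > 0" and
    idem_m: "\<And>\<alpha>. \<alpha> \<in> lverts \<Gamma> \<Longrightarrow>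
      (fold (step \<Gamma>) w ^^ m) ((fold (step \<Gamma>) w ^^ m) \<alpha>) = (fold (step \<Gamma>) w ^^ m) \<alpha>"
    using idempotent_power[OF finV, of "fold (step \<Gamma>) w"] fold_step_in_verts[OF wS] by metis
  define v where "v = concat (replicate m w)"
  have set_v: "set v = set w" using m by (auto simp: v_def)
  have vS: "set v \<subseteq> S" using wS set_v by simp
  have fold_v: "fold (step \<Gamma>) v = fold (step \<Gamma>) w ^^ m"
    by (simp add: v_def fold_concat_replicate)
  define P where "P = {\<alpha> \<in> lverts \<Gamma>. fold (step \<Gamma>) v \<alpha> = \<alpha>}"
  define X where "X = {x \<in> wverts \<Psi>. set v \<subseteq> wI \<Psi> x}"
  have "card P = card X" unfolding P_def X_def
    by (rule card_fixed_points_eq[OF labeled finV finX vS tau wop g bij comm])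
      (auto simp: fold_v idem_m)
  have finP: "finite P" using finV by (simp add: P_def)
  have "(fold (step \<Gamma>) w ^^ m) \<alpha>0 = \<alpha>0" using fixed by (induction m) auto
  then have "\<alpha>0 \<in> P" using \<alpha>0 by (simp add: P_def fold_v)

  define h where "h = inv_into (carrier (digraph_space \<Gamma>)) g"
  have h: "h \<in> module_hom Qu (free_space (wverts \<Psi>)) (free_space (lverts \<Gamma>))"
    using free_hom_inv g bij unfolding spaces h_def by blast
  have gh: "g (h y) = y" if "Poly_Mapping.keys y \<subseteq> wverts \<Psi>" for y
    using bij_betw_inv_into_right[OF bij, of y] that by (simp add: h_def spaces)
  have hg: "h (g y) = y" if "Poly_Mapping.keys y \<subseteq> lverts \<Gamma>" for y
    using bij_betw_inv_into_left[OF bij, of y] that by (simp add: h_def spaces)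
  have sign: "tau \<Gamma> s (h y) = scl (- 1) (h y)"
    if y: "Poly_Mapping.keys y \<subseteq> X" and s: "s \<in> set w" for y s
  proof -
    have yX: "Poly_Mapping.keys y \<subseteq> wverts \<Psi>" using y by (auto simp: X_def)
    have sS: "s \<in> S" using s wS by auto
    have "wgraph_op \<Psi> s y = scl (- 1) y"
    proof (rule poly_mapping_eqI)
      fix k
      have "Poly_Mapping.lookup (wgraph_op \<Psi> s y) k =
          (\<Sum>x\<in>wverts \<Psi>. Poly_Mapping.lookup y x * entry (wgraph_op \<Psi> s) x k)"
        using wop[OF sS] finX yX unfolding spaces by (intro lookup_free_hom)
      also have "\<dots> = (\<Sum>x\<in>wverts \<Psi>. if x = k then - Poly_Mapping.lookup y k else 0)"
      proof (rule sum.cong)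
        fix x assume x: "x \<in> wverts \<Psi>"
        show "Poly_Mapping.lookup y x * entry (wgraph_op \<Psi> s) x k =
            (if x = k then - Poly_Mapping.lookup y k else 0)"
        proof (cases "x \<in> X")
          case True
          then have "s \<in> wI \<Psi> x" using s set_v by (auto simp: X_def)
          then show ?thesis
            by (auto simp: entry_wgraph_op[OF x] wgraph_vec_def lookup_single when_def)
        next
          case False
          then have "Poly_Mapping.lookup y x = 0" using y by (auto simp: in_keys_iff)
          then show ?thesis by auto
        qed
      qed simp
      also have "\<dots> = Poly_Mapping.lookup (scl (- 1) y) k"
        using finX yX by (auto simp: in_keys_iff)
      finally show "Poly_Mapping.lookup (wgraph_op \<Psi> s y) k =
          Poly_Mapping.lookup (scl (- 1) y) k" .
    qed
    moreover have hy: "Poly_Mapping.keys (h y) \<subseteq> lverts \<Gamma>" using h yX by (simp add: free_hom_iff)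
    ultimately have "g (tau \<Gamma> s (h y)) = scl (- 1) y"
      using comm[OF sS, of "h y"] gh[OF yX] by (simp add: spaces)
    moreover have "Poly_Mapping.keys (tau \<Gamma> s (h y)) \<subseteq> lverts \<Gamma>"
      using tau[OF sS] hy by (simp add: free_hom_iff spaces)
    ultimately have "tau \<Gamma> s (h y) = h (scl (- 1) y)" using hg by metis
    also have "\<dots> = scl (- 1) (h y)" using h yX by (simp add: free_hom_iff)
    finally show ?thesis .
  qed

  (* a sign vector is determined by its values on P, and it vanishes at \<alpha>0 in any case *)
  have "card X \<le> card (P - {\<alpha>0})"
  proof (rule card_le_if_determined)
    show "h \<in> module_hom Qu (free_space X) (free_space (lverts \<Gamma>))"
      using h unfolding free_hom_iff X_def by blast
    show "finite X" "finite (P - {\<alpha>0})" using finX finP by (auto simp: X_def)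
    fix y assume y: "Poly_Mapping.keys y \<subseteq> X"
      and zero: "\<And>q. q \<in> P - {\<alpha>0} \<Longrightarrow> Poly_Mapping.lookup (h y) q = 0"
    have yX: "Poly_Mapping.keys y \<subseteq> wverts \<Psi>" using y by (auto simp: X_def)
    then have hy: "Poly_Mapping.keys (h y) \<subseteq> lverts \<Gamma>" using h by (simp add: free_hom_iff)
    have hom: "tau \<Gamma> s \<in> module_hom Qu (free_space (lverts \<Gamma>)) (free_space (lverts \<Gamma>))"
      if "s \<in> S" for s using tau[OF that] by (simp add: spaces)
    have zero_\<alpha>0: "Poly_Mapping.lookup (h y) \<alpha>0 = 0"
    proof -
      obtain c where c: "Poly_Mapping.lookup (h y) \<alpha>0 = c * Poly_Mapping.lookup (h y) \<alpha>0"
        "reduces_to c 0"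
        using sign_vector_fold_step[OF wS \<alpha>0 finV hom hy sign[OF y]] wS moved fixed
        by (metis subsetD)
      have "c \<noteq> 1" using reduces_to_unique[OF c(2)] reduces_to_1 by fastforce
      then show ?thesis using c(1) by simp
    qed
    have "Poly_Mapping.lookup (h y) \<alpha> = 0" if \<alpha>: "\<alpha> \<in> lverts \<Gamma>" for \<alpha>
    proof -
      obtain c where c: "Poly_Mapping.lookup (h y) \<alpha> =
          c * Poly_Mapping.lookup (h y) (fold (step \<Gamma>) v \<alpha>)"
        using sign_vector_fold_step[OF vS \<alpha> finV hom hy sign[OF y]] vS set_v by (metis subsetD)
      have "fold (step \<Gamma>) v \<alpha> \<in> P"
        using fold_step_in_verts[OF vS \<alpha>] idem_m[OF \<alpha>] by (simp add: P_def fold_v)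
      then show ?thesis using c zero zero_\<alpha>0 by (cases "fold (step \<Gamma>) v \<alpha> = \<alpha>0") auto
    qed
    then have "h y = 0" using hy by (intro poly_mapping_eqI) (metis in_keys_iff lookup_zero subsetD)
    moreover have "h 0 = 0"
    proof -
      have "h (scl 0 0) = scl 0 (h 0)" using h unfolding free_hom_iff by (metis empty_subsetI keys_zero)
      moreover have "scl 0 z = 0" for z :: "'z \<Rightarrow>\<^sub>0 ratfun" by (rule poly_mapping_eqI) simp
      ultimately show ?thesis by metis
    qed
    ultimately show "y = 0" using gh[OF yX] gh[of 0] by simp
  qed
  also have "\<dots> < card P" using finP \<open>\<alpha>0 \<in> P\<close> by (rule card_Diff1_less)
  finally show False using \<open>card P = card X\<close> by simp
qed

end
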